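(* Let $\Delta$ be a (finite) $(d-1)$-dimensional simplicial complex. Then $$h_j^{\mathrm{sd}^l(\Delta)}=\sum_{\mu=0}^d A(d+1,j,d+1-\mu,l)\,h_{\mu}^{\Delta}$$ for all $1\leq l\leq d-1$ and $0\leq j\leq d$.
   Context: For a $(d-1)$-dimensional simplicial complex $\Delta$, $f_i^\Delta$ is the number of $i$-dimensional faces ($f^\Delta_{-1}=1$), and the $h$-vector $h^\Delta=(h_0^\Delta,\ldots,h_d^\Delta)$ is defined by $\sum_{i=0}^d f^\Delta_{i-1}(x-1)^{d-i}=\sum_{i=0}^d h_i^\Delta x^{d-i}$. The $l$-th partial barycentric subdivision $\mathrm{sd}^l(\Delta)$, $1\leq l\leq d$, is the subdivision of $\Delta$ in which exactly the faces of dimension $\geq l$ are barycentrically subdivided. Combinatorially it is the following simplicial complex. Its vertices are the vertices of $\Delta$ together with one vertex (the barycenter) for each face $F\in\Delta$ with $\#F\geq l+1$. Its $(i-1)$-dimensional faces are indexed by strictly increasing chains $A_0\subset A_1\subset\cdots\subset A_r$ ($r\geq 0$) of faces of $\Delta$ such that $0\leq \#A_0\leq l$, $\#A_1\geq l+1$ (if $r\geq 1$), $\#A_0+r=i$ and $A_r\in\Delta$; the corresponding face has as vertices the elements of $A_0$ and the barycenters of $A_1,\ldots,A_r$. For $1\leq l\leq m$, $S_m^l$ is the set of permutations $\sigma$ of $[m]=\{1,\ldots,m\}$ with $\sigma(1)>\sigma(2)>\cdots>\sigma(l)$. For $1\leq l\leq m-1$ and $\sigma\in S_m^l$, the $l$-descent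 set $D^l(\sigma)$ consists of all $i\in[m-1]$ such that either $i\in[l]$ and $\sigma(i)>\sigma(l+1)$, or $i\in[m-1]\setminus[l]$ and $\sigma(i)>\sigma(i+1)$; and $\mathrm{des}^l(\sigma)=\#D^l(\sigma)$. For integers $i,k$, $A(m,i,k,l)$ is the number of $\sigma\in S_m^l$ with $\mathrm{des}^l(\sigma)=i$ and $\sigma(m)=k$. *)

theory Defs
  imports "HOL-Computational_Algebra.Polynomial" "HOL-Combinatorics.Permutations"
begin

text \<open>A simplicial complex is given by its set of faces, including the empty face; its vertices
  are the elements of the union of all faces. Accordingly the dimensions of faces and of complexes
  are integers, the empty face having dimension \<open>-1\<close>.\<close>

definition finite_simplicial_complex :: "'a set set \<Rightarrow> bool" where
  "finite_simplicial_complex \<Delta> \<longleftrightarrow>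
     finite \<Delta> \<and> {} \<in> \<Delta> \<and> (\<forall>F\<in>\<Delta>. finite F \<and> (\<forall>G. G \<subseteq> F \<longrightarrow> G \<in> \<Delta>))"

definition face_dim :: "'a set \<Rightarrow> int" where
  "face_dim F = int (card F) - 1"

definition complex_dim :: "'a set set \<Rightarrow> int" where
  "complex_dim \<Delta> = Max (face_dim ` \<Delta>)"

definition f_vec :: "'a set set \<Rightarrow> int \<Rightarrow> nat" where
  "f_vec \<Delta> i = card {F \<in> \<Delta>. face_dim F = i}"

definition f_poly :: "'a set set \<Rightarrow> int poly" where
  "f_poly \<Delta> =
     (let d = nat (complex_dim \<Delta> + 1)
      in \<Sum>i=0..d. smult (int (f_vec \<Delta> (int i - 1))) ([:-1, 1:] ^ (d - i)))"

text \<open>The entry \<open>h\<^sub>i\<close> is the coefficient of \<open>x\<^bsup>d-i\<^esup>\<close> in the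
  polynomial above; see \<open>f_poly_eq_h_vec\<close> below for the usual defining equation.\<close>

definition h_vec :: "'a set set \<Rightarrow> nat \<Rightarrow> int" where
  "h_vec \<Delta> i =
     (let d = nat (complex_dim \<Delta> + 1) in if i \<le> d then coeff (f_poly \<Delta>) (d - i) else 0)"

lemma f_poly_eq_h_vec:
  assumes "complex_dim \<Delta> = int d - 1"
  shows "(\<Sum>i=0..d. smult (int (f_vec \<Delta> (int i - 1))) ([:-1, 1:] ^ (d - i))) =
         (\<Sum>i=0..d. monom (h_vec \<Delta> i) (d - i))" (is "?L = ?R")
proof -
  have d: "nat (complex_dim \<Delta> + 1) = d"
    using assms by simp
  have L: "f_poly \<Delta> = ?L"
    unfolding f_poly_def Let_def d ..
  have "degree ([:-1, 1:] ^ (d - i) :: int poly) \<le> d" for i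
    by (rule order_trans[OF degree_power_le]) simp
  then have deg: "degree ?L \<le> d"
    by (intro degree_sum_le) (auto intro: order_trans[OF degree_smult_le])
  have "?R = (\<Sum>i=0..d. monom (h_vec \<Delta> (d - i)) i)"
    by (rule sum.reindex_bij_witness[of _ "\<lambda>i. d - i" "\<lambda>i. d - i"]) auto
  also have "\<dots> = (\<Sum>i\<le>d. monom (coeff ?L i) i)"
    using L by (intro sum.cong) (auto simp: h_vec_def d)
  also have "\<dots> = ?L"
    by (rule poly_as_sum_of_monoms'[OF deg])
  finally show ?thesis ..
qed

text \<open>The partial barycentric subdivision. The vertex \<open>Inl v\<close> is the original vertex \<open>v\<close> and
  \<open>Inr F\<close> is the barycenter of \<open>F\<close>. The list \<open>A\<^sub>0 # As\<close> is a chain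
  \<open>A\<^sub>0 \<subset> A\<^sub>1 \<subset> \<dots> \<subset> A\<^sub>r\<close> with \<open>r = length As\<close>.\<close>

definition partial_sd :: "nat \<Rightarrow> 'a set set \<Rightarrow> ('a + 'a set) set set" where
  "partial_sd l \<Delta> =
     {Inl ` A\<^sub>0 \<union> Inr ` set As | A\<^sub>0 As.
        set (A\<^sub>0 # As) \<subseteq> \<Delta> \<and> sorted_wrt (\<subset>) (A\<^sub>0 # As) \<and>
        card A\<^sub>0 \<le> l \<and> (As \<noteq> [] \<longrightarrow> l + 1 \<le> card (hd As))}"

definition S_perms :: "nat \<Rightarrow> nat \<Rightarrow> (nat \<Rightarrow> nat) set" where
  "S_perms m l = {\<sigma>. \<sigma> permutes {1..m} \<and> strict_antimono_on {1..l} \<sigma>}"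

definition descent_set :: "nat \<Rightarrow> nat \<Rightarrow> (nat \<Rightarrow> nat) \<Rightarrow> nat set" where
  "descent_set m l \<sigma> =
     {i \<in> {1..m-1}. (i \<in> {1..l} \<and> \<sigma> i > \<sigma> (l + 1)) \<or> (i \<notin> {1..l} \<and> \<sigma> i > \<sigma> (i + 1))}"

definition des :: "nat \<Rightarrow> nat \<Rightarrow> (nat \<Rightarrow> nat) \<Rightarrow> nat" where
  "des m l \<sigma> = card (descent_set m l \<sigma>)"

definition A_num :: "nat \<Rightarrow> int \<Rightarrow> int \<Rightarrow> nat \<Rightarrow> nat" where
  "A_num m i k l = card {\<sigma> \<in> S_perms m l. int (des m l \<sigma>) = i \<and> int (\<sigma> m) = k}"

end

theory Submission
  imports Defs "HOL-Library.Product_Lexorder" "HOL-Library.Infinite_Set"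
begin

text \<open>
  Put \<open>y = x - 1\<close>. The polynomial that defines the h-vector of a complex of dimension \<open>d - 1\<close> is
  the sum of \<open>y\<^bsup>d - #F\<^esup>\<close> over its faces \<open>F\<close>. For the subdivision this is a sum over
  chains \<open>A\<^sub>0 \<subset> \<dots> \<subset> A\<^sub>r\<close>, and collecting the chains with the same largest set
  \<open>A\<^sub>r = F\<close> turns it into a sum \<open>\<Sum>\<^bsub>F\<in>\<Delta>\<^esub> w(#F)\<close> (lemma \<open>f_poly_partial_sd\<close>): how many
  chains of a given size end in \<open>F\<close> depends on the cardinality of \<open>F\<close> only.

  Any such sum is a combination of the numbers \<open>h\<^sub>\<mu>\<close>. By definition
  \<open>\<Sum>\<^bsub>F\<in>\<Delta>\<^esub> y\<^bsup>d - #F\<^esup> = \<Sum>\<^sub>\<mu> h\<^sub>\<mu> (1 + y)\<^bsup>d - \<mu>\<^esup>\<close>, and \<open>(1 + y)\<^bsup>d - \<mu>\<^esup>\<close> enumerates a Boolean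
  interval \<open>D \<subseteq> F \<subseteq> E\<close> with \<open>#D = \<mu>\<close> and \<open>#E = d\<close>. Hence \<open>\<Delta>\<close> has as many faces of each size as
  a formal disjoint union of \<open>h\<^sub>\<mu>\<close> copies of such an interval, \<open>0 \<le> \<mu> \<le> d\<close>, and for summing a
  function of \<open>#F\<close> nothing else matters (lemma \<open>sum_over_faces_from_h_vec\<close>). We take
  \<open>D = {k+1,\<dots>,d+1}\<close> and \<open>E = [d+1] - {k}\<close> with \<open>k = d + 1 - \<mu>\<close>.

  It remains to see that the chains of subsets of \<open>[d+1]\<close> whose largest set omits \<open>k\<close> and contains
  all larger numbers, each weighted by \<open>y\<^bsup>d - #A\<^sub>0 - r\<^esup>\<close>, add up to the sum of
  \<open>x\<^bsup>d - des(\<sigma>)\<^esup>\<close> over the permutations \<open>\<sigma>\<close> in \<open>S_perms (d+1) l\<close> that end in \<open>k\<close>. Since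
  \<open>x = 1 + y\<close>, the term of \<open>\<sigma>\<close> is the sum of \<open>y\<^bsup>d - #T\<^esup>\<close> over the sets \<open>T\<close> between the descent
  set of \<open>\<sigma>\<close> and \<open>[d]\<close>. So the claim follows from a bijection between pairs \<open>(\<sigma>, T)\<close> and chains
  that takes \<open>#T\<close> to \<open>#A\<^sub>0 + r\<close> (lemma \<open>perm_chain_size_preserving_bij\<close>). It reads \<open>\<sigma>\<close> as a
  word: the letters at positions \<open>i \<le> l\<close> in \<open>T\<close> form \<open>A\<^sub>0\<close>, and every \<open>t > l\<close> in \<open>T\<close> contributes
  the set of the first \<open>t\<close> letters.

  The word can be recovered from the chain. The elements of \<open>T\<close> greater than \<open>l\<close> cut it into blocks;
  each block is increasing after the first \<open>l\<close> letters, because all descents are in \<open>T\<close>. Among the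
  first \<open>l\<close> letters, which are decreasing, those outside \<open>A\<^sub>0\<close> are smaller than the letter at \<open>l + 1\<close>
  and therefore than all other letters of the first block; so they are the smallest elements of that
  block outside \<open>A\<^sub>0\<close>. The last letter is the largest element outside the largest set of the chain,
  which is how \<open>k\<close> enters.
\<close>

section \<open>Face numbers in terms of the h-vector\<close>

text \<open>The binomial theorem, summed over the sets \<open>T = D \<union> S\<close> with \<open>S \<subseteq> E - D\<close>. It is used both for
  intervals of faces and for the sets that contain a given descent set.\<close>

lemma sum_power_interval:
  fixes y :: "'b::comm_semiring_1"
  assumes "finite E" and "D \<subseteq> E"
  shows "(\<Sum>T\<in>{D..E}. y ^ (card E - card T)) = (1 + y) ^ (card E - card D)"
proof -
  have fin: "finite (E - D)" "finite D"
    using assms finite_subset by auto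
  have card_split: "card E - card (D \<union> S) = card (E - D - S)" if "S \<subseteq> E - D" for S
  proof -
    have "E - D - S = E - (D \<union> S)" "D \<union> S \<subseteq> E"
      using that assms by auto
    then show ?thesis
      using assms by (metis card_Diff_subset finite_subset)
  qed
  have "(1 + y) ^ (card E - card D) = (\<Prod>x\<in>E - D. 1 + y)"
    using assms fin by (simp add: card_Diff_subset)
  also have "\<dots> = (\<Sum>S\<in>Pow (E - D). y ^ card (E - D - S))"
    using fin prod_add[of "E - D" "\<lambda>_. 1" "\<lambda>_. y"] by simp
  also have "\<dots> = (\<Sum>T\<in>{D..E}. y ^ (card E - card T))"
    by (rule sum.reindex_bij_witness[of _ "\<lambda>T. T - D" "\<lambda>S. D \<union> S"])
      (use assms card_split in auto)
  finally show ?thesis ..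
qed

lemma descent_set_subset: "descent_set m l \<sigma> \<subseteq> {1..m-1}"
  by (auto simp: descent_set_def)

lemma finite_set_interval:
  assumes "finite E"
  shows "finite {D..E :: 'b set}"
  by (rule finite_subset[of _ "Pow E"]) (use assms in auto)

lemma card_face_le:
  assumes "finite K" and "complex_dim K = int d - 1" and "F \<in> K"
  shows "card F \<le> d"
proof -
  have "face_dim F \<le> complex_dim K"
    unfolding complex_dim_def using assms by (intro Max_ge) auto
  then show ?thesis
    using assms by (simp add: face_dim_def)
qed

lemma f_poly_as_sum_over_faces:
  assumes "finite K" and "K \<noteq> {}" and dim: "complex_dim K = int d - 1"
  shows "f_poly K = (\<Sum>F\<in>K. [:-1, 1:] ^ (d - card F))"
proof -
  have d: "nat (complex_dim K + 1) = d"
    using dim by simp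
  note le = card_face_le[OF assms(1) dim]
  have f: "f_vec K (int i - 1) = card {F \<in> K. card F = i}" for i
    by (simp add: f_vec_def face_dim_def)
  have "f_poly K = (\<Sum>i=0..d. \<Sum>F | F \<in> K \<and> card F = i. [:-1, 1:] ^ (d - card F))"
    unfolding f_poly_def Let_def d f
    by (intro sum.cong refl) (simp add: of_nat_poly)
  also have "\<dots> = (\<Sum>F\<in>K. [:-1, 1:] ^ (d - card F))"
    by (rule sum.group) (use assms(1) le in auto)
  finally show ?thesis .
qed

text \<open>Substituting \<open>x + 1\<close> for \<open>x\<close> turns the powers of \<open>x - 1\<close> into monomials, so that
  coefficients can be compared.\<close>

lemma pcompose_shift_power:
  "pcompose ([:-1, 1:] ^ n) [:1, 1:] = (monom 1 n :: int poly)"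
proof (induction n)
  case 0
  show ?case by (simp add: one_pCons)
next
  case (Suc n)
  then show ?case
    by (simp add: pcompose_mult pcompose_pCons monom_Suc del: mult_pCons_left) simp
qed

text \<open>Face numbers are those of a formal union of \<open>h\<^sub>\<mu>\<close> copies of an interval of rank \<open>d - \<mu>\<close>: with
  \<open>y = x - 1\<close>, the defining polynomial is \<open>\<Sum>\<^sub>\<mu> h\<^sub>\<mu> x\<^bsup>d - \<mu>\<^esup>\<close>, and \<open>x\<^bsup>d - \<mu>\<^esup> = (1 + y)\<^bsup>d - \<mu>\<^esup>\<close> is the
  enumerator of that interval. The intervals stay arbitrary here; working with them instead of with
  binomial coefficients keeps the statement in the form in which the chains will be counted.\<close>

lemma card_faces_from_h_vec:
  fixes D E :: "nat \<Rightarrow> 'b set"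
  assumes cplx: "finite_simplicial_complex \<Delta>" and dim: "complex_dim \<Delta> = int d - 1"
    and I: "\<And>\<mu>. \<mu> \<le> d \<Longrightarrow>
      finite (E \<mu>) \<and> D \<mu> \<subseteq> E \<mu> \<and> card (E \<mu>) = d \<and> card (D \<mu>) = \<mu>"
    and "k \<le> d"
  shows "int (card {F \<in> \<Delta>. card F = k}) =
    (\<Sum>\<mu>=0..d. h_vec \<Delta> \<mu> * int (card {F \<in> {D \<mu>..E \<mu>}. card F = k}))"
proof -
  let ?y = "[:-1, 1:] :: int poly"
  have fin: "finite \<Delta>" and ne: "\<Delta> \<noteq> {}"
    using cplx by (auto simp: finite_simplicial_complex_def)
  note le = card_face_le[OF fin dim]
  have finI: "finite ({D \<mu>..E \<mu>})" if "\<mu> \<le> d" for \<mu>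
    using I[OF that] by (simp add: finite_set_interval)
  have leI: "card F \<le> d" if "F \<in> {D \<mu>..E \<mu>}" "\<mu> \<le> d" for F \<mu>
    using I[OF that(2)] that(1) card_mono[of "E \<mu>" F] by simp
  have "(\<Sum>F\<in>\<Delta>. ?y ^ (d - card F)) = f_poly \<Delta>"
    using f_poly_as_sum_over_faces[OF fin ne dim] by simp
  also have "\<dots> = (\<Sum>\<mu>=0..d. monom (h_vec \<Delta> \<mu>) (d - \<mu>))"
    using f_poly_eq_h_vec[OF dim] dim by (simp add: f_poly_def Let_def)
  also have "\<dots> = (\<Sum>\<mu>=0..d. smult (h_vec \<Delta> \<mu>) (\<Sum>F\<in>{D \<mu>..E \<mu>}. ?y ^ (d - card F)))"
  proof (intro sum.cong refl)
    fix \<mu> assume "\<mu> \<in> {0..d}"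
    then have "(\<Sum>F\<in>{D \<mu>..E \<mu>}. ?y ^ (d - card F)) = (1 + ?y) ^ (d - \<mu>)"
      using sum_power_interval[of "E \<mu>" "D \<mu>" ?y] I[of \<mu>] by simp
    also have "1 + ?y = monom 1 1"
      by (simp add: one_pCons monom_Suc)
    finally show "monom (h_vec \<Delta> \<mu>) (d - \<mu>) = smult (h_vec \<Delta> \<mu>) (\<Sum>F\<in>{D \<mu>..E \<mu>}. ?y ^ (d - card F))"
      by (simp add: monom_power smult_monom)
  qed
  finally have "pcompose (\<Sum>F\<in>\<Delta>. ?y ^ (d - card F)) [:1, 1:] = pcompose \<dots> [:1, 1:]"
    by simp
  then have "(\<Sum>F\<in>\<Delta>. monom 1 (d - card F)) =
      (\<Sum>\<mu>=0..d. smult (h_vec \<Delta> \<mu>) (\<Sum>F\<in>{D \<mu>..E \<mu>}. monom 1 (d - card F)))"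
    by (simp add: pcompose_sum pcompose_smult pcompose_shift_power)
  then have "coeff (\<Sum>F\<in>\<Delta>. monom (1::int) (d - card F)) (d - k) = coeff \<dots> (d - k)"
    by simp
  moreover have count: "(\<Sum>F\<in>K. if d - card F = d - k then 1 else 0) = int (card {F \<in> K. card F = k})"
    if "finite K" "\<And>F. F \<in> K \<Longrightarrow> card F \<le> d" for K :: "'c set set"
  proof -
    have "{F \<in> K. d - card F = d - k} = {F \<in> K. card F = k}"
      using that(2) \<open>k \<le> d\<close> by force
    then show ?thesis
      using that(1) by (simp add: sum.If_cases Int_def)
  qed
  ultimately show ?thesis
    using count[OF fin le] count[OF finI leI] by (simp add: coeff_sum)
qed

lemma smult_sum_right: "smult c (\<Sum>x\<in>S. p x) = (\<Sum>x\<in>S. smult c (p x))"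
  by (simp add: poly_eq_iff coeff_sum sum_distrib_left)

lemma sum_over_faces_from_h_vec:
  fixes D E :: "nat \<Rightarrow> 'b set" and w :: "nat \<Rightarrow> int poly"
  assumes cplx: "finite_simplicial_complex \<Delta>" and dim: "complex_dim \<Delta> = int d - 1"
    and I: "\<And>\<mu>. \<mu> \<le> d \<Longrightarrow>
      finite (E \<mu>) \<and> D \<mu> \<subseteq> E \<mu> \<and> card (E \<mu>) = d \<and> card (D \<mu>) = \<mu>"
  shows "(\<Sum>F\<in>\<Delta>. w (card F)) = (\<Sum>\<mu>=0..d. smult (h_vec \<Delta> \<mu>) (\<Sum>F\<in>{D \<mu>..E \<mu>}. w (card F)))"
proof -
  have fin: "finite \<Delta>"
    using cplx by (auto simp: finite_simplicial_complex_def)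
  note le = card_face_le[OF fin dim]
  have finI: "finite ({D \<mu>..E \<mu>})" if "\<mu> \<le> d" for \<mu>
    using I[OF that] by (simp add: finite_set_interval)
  have leI: "card F \<le> d" if "F \<in> {D \<mu>..E \<mu>}" "\<mu> \<le> d" for F \<mu>
    using I[OF that(2)] that(1) card_mono[of "E \<mu>" F] by simp
  have by_card: "(\<Sum>F\<in>K. w (card F)) = (\<Sum>k=0..d. smult (int (card {F \<in> K. card F = k})) (w k))"
    if "finite K" "\<And>F. F \<in> K \<Longrightarrow> card F \<le> d" for K :: "'c set set"
  proof -
    have "(\<Sum>F\<in>K. w (card F)) = (\<Sum>k=0..d. \<Sum>F | F \<in> K \<and> card F = k. w (card F))"
      by (rule sum.group[symmetric]) (use that in auto)
    then show ?thesis
      by (simp add: of_nat_poly)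
  qed
  have "(\<Sum>F\<in>\<Delta>. w (card F)) =
      (\<Sum>k=0..d. \<Sum>\<mu>=0..d. smult (h_vec \<Delta> \<mu>) (smult (int (card {F \<in> {D \<mu>..E \<mu>}. card F = k})) (w k)))"
    using by_card[OF fin le] card_faces_from_h_vec[OF cplx dim I]
    by (simp add: smult_sum)
  also have "\<dots> = (\<Sum>\<mu>=0..d. smult (h_vec \<Delta> \<mu>)
      (\<Sum>k=0..d. smult (int (card {F \<in> {D \<mu>..E \<mu>}. card F = k})) (w k)))"
    by (subst sum.swap) (simp add: smult_sum_right)
  also have "\<dots> = (\<Sum>\<mu>=0..d. smult (h_vec \<Delta> \<mu>) (\<Sum>F\<in>{D \<mu>..E \<mu>}. w (card F)))"
    using by_card[OF finI leI] by simp
  finally show ?thesis .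
qed

section \<open>Faces of the subdivision as chains\<close>

text \<open>A pair \<open>(A, C)\<close> stands for the chain that starts with \<open>A\<close> and continues through the members of
  \<open>C\<close>; the inclusions are strict since \<open>card A \<le> l\<close> and the members of \<open>C\<close> are larger than \<open>l\<close>. The
  largest set of a chain is its union, so \<open>F\<close> is the largest set, also when \<open>C\<close> is empty.\<close>

definition sd_chains :: "nat \<Rightarrow> 'a set \<Rightarrow> ('a set \<times> 'a set set) set" where
  "sd_chains l F = {(A, C). chain\<^sub>\<subseteq> C \<and> card A \<le> l \<and> (\<forall>B\<in>C. A \<subseteq> B \<and> l < card B) \<and> A \<union> \<Union>C = F}"

lemma sd_chainsD:
  assumes "(A, C) \<in> sd_chains l F" and "finite F"
  shows "finite A" "finite C" "A \<subseteq> F" "\<And>B. B \<in> C \<Longrightarrow> B \<subseteq> F" "\<And>B. B \<in> C \<Longrightarrow> finite B"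
    "\<And>B B'. B \<in> C \<Longrightarrow> B' \<in> C \<Longrightarrow> B \<subseteq> B' \<or> B' \<subseteq> B"
    "card A \<le> l" "\<And>B. B \<in> C \<Longrightarrow> A \<subseteq> B" "\<And>B. B \<in> C \<Longrightarrow> l < card B"
proof -
  have F: "A \<union> \<Union>C = F"
    using assms by (simp add: sd_chains_def)
  then show "finite A" "A \<subseteq> F" and sub: "\<And>B. B \<in> C \<Longrightarrow> B \<subseteq> F"
    using assms(2) by auto
  show "\<And>B. B \<in> C \<Longrightarrow> finite B"
    using sub assms(2) by (rule finite_subset)
  have "C \<subseteq> Pow F"
    using sub by blast
  then show "finite C"
    using assms(2) by (simp add: finite_subset)
qed (use assms in \<open>auto simp: sd_chains_def chain_subset_def\<close>)

lemma finite_sd_chains: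
  assumes "finite F"
  shows "finite (sd_chains l F)"
proof (rule finite_subset)
  show "sd_chains l F \<subseteq> Pow F \<times> Pow (Pow F)"
    by (auto simp: sd_chains_def)
qed (use assms in auto)

lemma inj_on_card_chain:
  assumes "chain\<^sub>\<subseteq> C" and "\<And>B. B \<in> C \<Longrightarrow> finite B"
  shows "inj_on card C"
  using assms unfolding inj_on_def chain_subset_def by (metis card_subset_eq)

text \<open>The sets in \<open>C\<close> have distinct cardinalities between \<open>l + 1\<close> and \<open>card F\<close>, and \<open>A\<close> has at most
  \<open>l\<close> elements.\<close>

lemma card_sd_chain_le:
  assumes ch: "(A, C) \<in> sd_chains l F" and F: "finite F"
  shows "card A + card C \<le> card F"
proof (cases "C = {}")
  case True
  then show ?thesis
    using sd_chainsD[OF ch F] F by (simp add: card_mono)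
next
  case False
  note D = sd_chainsD[OF ch F]
  have inj: "inj_on card C"
    using D ch by (intro inj_on_card_chain) (auto simp: sd_chains_def)
  have "card ` C \<subseteq> {l<..card F}"
    using card_mono[OF F D(4)] D(9) by auto
  then have "card C \<le> card F - l"
    using card_mono[of "{l<..card F}" "card ` C"] card_image[OF inj] by simp
  moreover have "l \<le> card F"
    using False D F by (meson card_mono ex_in_conv less_imp_le_nat order_trans)
  ultimately show ?thesis
    using D(7) by linarith
qed

lemma strict_chain_as_list:
  assumes "finite C" and "chain\<^sub>\<subseteq> C"
  shows "\<exists>Bs. set Bs = C \<and> sorted_wrt (\<subset>) Bs"
  using assms
proof (induction "card C" arbitrary: C)
  case 0
  then show ?case by auto
next
  case (Suc n)
  let ?M = "\<Union>C"
  have M: "?M \<in> C"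
    using Suc.hyps(2) Suc.prems by (intro Union_in_chain) (auto simp: chain_subset_alt_def)
  obtain Bs where Bs: "set Bs = C - {?M}" "sorted_wrt (\<subset>) Bs"
  proof -
    have "n = card (C - {?M})" "chain\<^sub>\<subseteq> (C - {?M})"
      using Suc.hyps(2) Suc.prems M by (auto simp: chain_subset_def)
    then show ?thesis
      using Suc.hyps(1)[of "C - {?M}"] Suc.prems(1) that by auto
  qed
  then have "set (Bs @ [?M]) = C" "sorted_wrt (\<subset>) (Bs @ [?M])"
    using M by (auto simp: sorted_wrt_append)
  then show ?case by blast
qed

lemma chain_of_strict_list:
  assumes "sorted_wrt (\<subset>) Bs"
  shows "chain\<^sub>\<subseteq> (set Bs)"
  using assms by (induction Bs) (auto simp: chain_subset_def)

definition sd_face :: "'a set \<times> 'a set set \<Rightarrow> ('a + 'a set) set" where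
  "sd_face = (\<lambda>(A, C). Inl ` A \<union> Inr ` C)"

lemma inj_sd_face: "inj sd_face"
proof (rule injI)
  fix p q :: "'a set \<times> 'a set set" assume eq: "sd_face p = sd_face q"
  have "A = Inl -` sd_face (A, C)" "C = Inr -` sd_face (A, C)" for A :: "'a set" and C
    by (auto simp: sd_face_def)
  with eq show "p = q"
    by (metis prod.exhaust_sel)
qed

lemma card_sd_face:
  assumes "finite A" and "finite C"
  shows "card (sd_face (A, C)) = card A + card C"
  using assms by (simp add: sd_face_def card_Plus flip: Plus_def)

lemma partial_sd_eq_sd_chains:
  assumes cplx: "finite_simplicial_complex \<Delta>"
  shows "partial_sd l \<Delta> = sd_face ` (\<Union>F\<in>\<Delta>. sd_chains l F)"
proof (intro equalityI subsetI)
  fix G assume "G \<in> partial_sd l \<Delta>"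
  then obtain A Bs where G: "G = Inl ` A \<union> Inr ` set Bs" and "set (A # Bs) \<subseteq> \<Delta>"
    and sorted: "sorted_wrt (\<subset>) (A # Bs)" and A: "card A \<le> l"
    and hd: "Bs \<noteq> [] \<longrightarrow> l + 1 \<le> card (hd Bs)"
    unfolding partial_sd_def by blast
  then have sub: "insert A (set Bs) \<subseteq> \<Delta>"
    by simp
  have ch: "chain\<^sub>\<subseteq> (insert A (set Bs))"
    using chain_of_strict_list[OF sorted] by simp
  have large: "l < card B" if "B \<in> set Bs" for B
  proof -
    have "hd Bs \<subseteq> B"
      using sorted that by (cases Bs) auto
    moreover have "finite B"
      using sub that cplx by (auto simp: finite_simplicial_complex_def)
    ultimately have "card (hd Bs) \<le> card B"
      by (simp add: card_mono)
    then show ?thesis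
      using hd that by fastforce
  qed
  have "A \<union> \<Union>(set Bs) \<in> \<Delta>"
  proof -
    have "\<Union>(insert A (set Bs)) \<in> insert A (set Bs)"
      using ch unfolding chain_subset_alt_def by (intro Union_in_chain) simp_all
    then show ?thesis
      using sub by (metis Sup_insert subsetD)
  qed
  moreover have "(A, set Bs) \<in> sd_chains l (A \<union> \<Union>(set Bs))"
    using ch sorted A large by (auto simp: sd_chains_def chain_subset_def)
  ultimately show "G \<in> sd_face ` (\<Union>F\<in>\<Delta>. sd_chains l F)"
    using G by (force simp: sd_face_def)
next
  fix G assume "G \<in> sd_face ` (\<Union>F\<in>\<Delta>. sd_chains l F)"
  then obtain A C F where G: "G = Inl ` A \<union> Inr ` C" and F: "F \<in> \<Delta>"
    and ch: "(A, C) \<in> sd_chains l F"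
    by (auto simp: sd_face_def)
  have closed: "finite F" "\<And>B. B \<subseteq> F \<Longrightarrow> B \<in> \<Delta>"
    using F cplx by (auto simp: finite_simplicial_complex_def)
  note D = sd_chainsD[OF ch closed(1)]
  have "chain\<^sub>\<subseteq> C"
    using ch by (simp add: sd_chains_def)
  then obtain Bs where Bs: "set Bs = C" "sorted_wrt (\<subset>) Bs"
    using strict_chain_as_list[OF D(2)] by blast
  have "A \<subset> B" if "B \<in> C" for B
    using D(7,8,9) that by (metis leD psubsetI)
  then have "set (A # Bs) \<subseteq> \<Delta>" "sorted_wrt (\<subset>) (A # Bs)"
      "Bs \<noteq> [] \<longrightarrow> l + 1 \<le> card (hd Bs)"
    using Bs D closed(2) by (auto simp: Suc_le_eq)
  then show "G \<in> partial_sd l \<Delta>"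
    unfolding partial_sd_def G using D(7) Bs(1) by blast
qed

text \<open>The subdivision keeps the dimension: the bound is \<open>card_sd_chain_le\<close>, and it is attained by the
  chain of all initial segments of lengths \<open>l, l + 1, \<dots>, d\<close> in an enumeration of a face with \<open>d\<close>
  elements.\<close>

lemma complex_dim_partial_sd:
  assumes cplx: "finite_simplicial_complex \<Delta>" and dim: "complex_dim \<Delta> = int d - 1"
    and "l \<le> d"
  shows "complex_dim (partial_sd l \<Delta>) = int d - 1"
proof -
  have fin: "finite \<Delta>" "\<Delta> \<noteq> {}" "\<And>F. F \<in> \<Delta> \<Longrightarrow> finite F"
    using cplx by (auto simp: finite_simplicial_complex_def)
  let ?K = "\<Union>F\<in>\<Delta>. sd_chains l F"
  have "int d - 1 \<in> face_dim ` \<Delta>"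
    using Max_in[of "face_dim ` \<Delta>"] fin(1,2) dim unfolding complex_dim_def by auto
  then obtain F where F: "F \<in> \<Delta>" "card F = d"
    by (auto simp: face_dim_def)
  then obtain f where f: "bij_betw f {..<d} F"
    using ex_bij_betw_nat_finite[of F] fin lessThan_atLeast0 by metis
  have inj: "inj_on f X" and card: "card (f ` X) = card X" if "X \<subseteq> {..<d}" for X
    using f that by (auto simp: bij_betw_def intro: inj_on_subset card_image)
  let ?A = "f ` {..<l}" and ?C = "(\<lambda>t. f ` {..<t}) ` {l<..d}"
  have "?A \<union> \<Union>?C = f ` {..<d}"
  proof (cases "l = d")
    case False
    then have "d \<in> {l<..d}"
      using \<open>l \<le> d\<close> by simp
    then show ?thesis
      using \<open>l \<le> d\<close> by fastforce
  qed auto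
  then have "?A \<union> \<Union>?C = F"
    using f by (simp add: bij_betw_def)
  have "chain\<^sub>\<subseteq> ?C"
    by (auto simp: chain_subset_def intro!: image_mono)
  have ch: "(?A, ?C) \<in> sd_chains l F"
  proof -
    have "card ?A \<le> l"
      using card[of "{..<l}"] \<open>l \<le> d\<close> by simp
    moreover have "?A \<subseteq> B \<and> l < card B" if "B \<in> ?C" for B
    proof -
      obtain t where t: "B = f ` {..<t}" "l < t" "t \<le> d"
        using \<open>B \<in> ?C\<close> by (elim imageE) simp
      then show ?thesis
        using card[of "{..<t}"] by (simp add: image_mono)
    qed
    ultimately show ?thesis
      using \<open>?A \<union> \<Union>?C = F\<close> \<open>chain\<^sub>\<subseteq> ?C\<close> unfolding sd_chains_def by blast
  qed
  have "inj_on (\<lambda>t. f ` {..<t}) {l<..d}"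
  proof (rule inj_onI)
    fix s t assume st: "s \<in> {l<..d}" "t \<in> {l<..d}" and eq: "f ` {..<s} = f ` {..<t}"
    have "card (f ` {..<s}) = s" "card (f ` {..<t}) = t"
      using card[of "{..<s}"] card[of "{..<t}"] st by simp_all
    then show "s = t"
      unfolding eq by (rule trans[OF sym])
  qed
  then have "card ?C = d - l"
    by (simp add: card_image)
  then have "card (sd_face (?A, ?C)) = d"
    using \<open>l \<le> d\<close> card[of "{..<l}"] by (subst card_sd_face) auto
  then have "int d - 1 \<in> face_dim ` sd_face ` ?K"
  proof -
    have "sd_face (?A, ?C) \<in> sd_face ` ?K"
      using ch F(1) by blast
    moreover have "int d - 1 = face_dim (sd_face (?A, ?C))"
      unfolding face_dim_def \<open>card (sd_face (?A, ?C)) = d\<close> ..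
    ultimately show ?thesis
      by (rule rev_image_eqI)
  qed
  moreover have "face_dim G \<le> int d - 1" if "G \<in> sd_face ` ?K" for G
  proof -
    obtain A C F where G: "G = sd_face (A, C)" "(A, C) \<in> sd_chains l F" "F \<in> \<Delta>"
      using \<open>G \<in> sd_face ` ?K\<close> by auto
    then have "card G \<le> card F"
      using card_sd_chain_le[OF G(2)] sd_chainsD(1,2)[OF G(2)] fin(3) by (simp add: card_sd_face)
    also have "\<dots> \<le> d"
      using card_face_le[OF fin(1) dim G(3)] .
    finally show ?thesis
      by (simp add: face_dim_def)
  qed
  moreover have "finite (sd_face ` ?K)"
    using fin by (intro finite_imageI finite_UN_I finite_sd_chains) auto
  ultimately have "Max (face_dim ` sd_face ` ?K) = int d - 1"
    by (intro Max_eqI) auto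
  then show ?thesis
    unfolding complex_dim_def partial_sd_eq_sd_chains[OF cplx] .
qed

lemma sd_chains_image:
  assumes ch: "(A, C) \<in> sd_chains l F" and "finite F" and inj: "inj_on f F"
  shows "(f ` A, (`) f ` C) \<in> sd_chains l (f ` F)"
    and "card (f ` A) = card A" and "card ((`) f ` C) = card C"
proof -
  note D = sd_chainsD[OF ch \<open>finite F\<close>]
  have "chain\<^sub>\<subseteq> ((`) f ` C)"
    using D(6) by (simp add: chain_subset_def) (meson image_mono)
  moreover have card_image: "card (f ` B) = card B" if "B \<subseteq> F" for B
    using inj that by (meson card_image inj_on_subset)
  moreover have "A \<union> \<Union>C = F"
    using ch by (simp add: sd_chains_def)
  moreover have "f ` A \<union> \<Union>((`) f ` C) = f ` (A \<union> \<Union>C)"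
    by auto
  ultimately show "(f ` A, (`) f ` C) \<in> sd_chains l (f ` F)"
    using D(3,4,7,8,9) by (simp add: sd_chains_def image_mono)
  show "card (f ` A) = card A"
    by (rule card_image[OF D(3)])
  have "inj_on ((`) f) C"
    using inj_on_image_Pow[OF inj] D(4) by (meson PowI inj_on_subset subsetI)
  then show "card ((`) f ` C) = card C"
    by (rule Finite_Set.card_image)
qed

lemma sum_sd_chains_image:
  assumes "finite F" and inj: "inj_on f F"
  shows "(\<Sum>(A, C)\<in>sd_chains l (f ` F). w (card A + card C)) =
    (\<Sum>(A, C)\<in>sd_chains l F. w (card A + card C))"
proof -
  define g where "g = inv_into F f"
  have g: "g ` f ` F = F" "inj_on g (f ` F)" "\<And>B. B \<subseteq> F \<Longrightarrow> g ` f ` B = B"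
      "\<And>B. B \<subseteq> f ` F \<Longrightarrow> f ` g ` B = B"
    using inj unfolding g_def
    by (simp_all add: inj_on_inv_into inv_into_image_cancel image_inv_into_cancel[OF refl])
  have cancel: "(`) h ` (`) h' ` C = C" if "\<And>B. B \<in> C \<Longrightarrow> h ` h' ` B = B"
    for h :: "'x \<Rightarrow> 'y" and h' and C
    unfolding image_image[of "(`) h" "(`) h'"] using that by simp
  show ?thesis
  proof (rule sum.reindex_bij_witness[of _ "\<lambda>(A, C). (f ` A, (`) f ` C)" "\<lambda>(A, C). (g ` A, (`) g ` C)"])
    fix p assume p: "p \<in> sd_chains l (f ` F)"
    obtain A C where AC: "p = (A, C)"
      by fastforce
    note ch = p[unfolded AC]
    note D = sd_chainsD[OF ch finite_imageI[OF \<open>finite F\<close>]]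
    have "f ` g ` A = A" "(`) f ` (`) g ` C = C"
      by (rule g(4)[OF D(3)]) (rule cancel[OF g(4)[OF D(4)]])
    then show "(case case p of (A, C) \<Rightarrow> (g ` A, (`) g ` C) of (A, C) \<Rightarrow> (f ` A, (`) f ` C)) = p"
      by (simp add: AC)
    show "(case p of (A, C) \<Rightarrow> (g ` A, (`) g ` C)) \<in> sd_chains l F"
      using sd_chains_image[OF ch finite_imageI[OF \<open>finite F\<close>] g(2)] g(1) by (simp add: AC)
    show "(case case p of (A, C) \<Rightarrow> (g ` A, (`) g ` C) of (A, C) \<Rightarrow> w (card A + card C)) =
        (case p of (A, C) \<Rightarrow> w (card A + card C))"
      using sd_chains_image[OF ch finite_imageI[OF \<open>finite F\<close>] g(2)] by (simp add: AC)
  next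
    fix p assume p: "p \<in> sd_chains l F"
    obtain A C where AC: "p = (A, C)"
      by fastforce
    note ch = p[unfolded AC]
    note D = sd_chainsD[OF ch \<open>finite F\<close>]
    have "g ` f ` A = A" "(`) g ` (`) f ` C = C"
      by (rule g(3)[OF D(3)]) (rule cancel[OF g(3)[OF D(4)]])
    then show "(case case p of (A, C) \<Rightarrow> (f ` A, (`) f ` C) of (A, C) \<Rightarrow> (g ` A, (`) g ` C)) = p"
      by (simp add: AC)
    show "(case p of (A, C) \<Rightarrow> (f ` A, (`) f ` C)) \<in> sd_chains l (f ` F)"
      using sd_chains_image[OF ch \<open>finite F\<close> inj] by (simp add: AC)
  qed
qed

text \<open>What a face with \<open>k\<close> elements contributes to the polynomial of the subdivision, computed in
  the model face \<open>{..<k}\<close>.\<close>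

definition sd_weight :: "nat \<Rightarrow> nat \<Rightarrow> nat \<Rightarrow> int poly" where
  "sd_weight d l k = (\<Sum>(A, C)\<in>sd_chains l {..<k}. [:-1, 1:] ^ (d - (card A + card C)))"

lemma sum_sd_chains_eq_weight:
  assumes "finite F"
  shows "(\<Sum>(A, C)\<in>sd_chains l F. [:-1, 1:] ^ (d - (card A + card C))) = sd_weight d l (card F)"
proof -
  obtain f where "bij_betw f {..<card F} F"
    using ex_bij_betw_nat_finite[OF assms] lessThan_atLeast0 by metis
  then have "inj_on f {..<card F}" "f ` {..<card F} = F"
    by (auto simp: bij_betw_def)
  then show ?thesis
    using sum_sd_chains_image[of "{..<card F}" f "\<lambda>i. [:-1, 1:] ^ (d - i) :: int poly" l]
    by (simp add: sd_weight_def)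
qed

lemma sum_over_chains_with_top_in:
  assumes "finite K" and "\<And>F. F \<in> K \<Longrightarrow> finite F"
  shows "(\<Sum>(A, C)\<in>(\<Union>F\<in>K. sd_chains l F). [:-1, 1:] ^ (d - (card A + card C))) =
    (\<Sum>F\<in>K. sd_weight d l (card F))"
proof -
  have "(\<Sum>(A, C)\<in>(\<Union>F\<in>K. sd_chains l F). [:-1, 1:] ^ (d - (card A + card C))) =
      (\<Sum>F\<in>K. \<Sum>(A, C)\<in>sd_chains l F. [:-1, 1:] ^ (d - (card A + card C)) :: int poly)"
    by (rule sum.UNION_disjoint) (use assms in \<open>auto simp: finite_sd_chains\<close>, auto simp: sd_chains_def)
  then show ?thesis
    using assms by (simp add: sum_sd_chains_eq_weight)
qed

lemma f_poly_partial_sd: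
  assumes cplx: "finite_simplicial_complex \<Delta>" and dim: "complex_dim \<Delta> = int d - 1" and "l \<le> d"
  shows "f_poly (partial_sd l \<Delta>) = (\<Sum>F\<in>\<Delta>. sd_weight d l (card F))"
proof -
  let ?K = "\<Union>F\<in>\<Delta>. sd_chains l F"
  have fin: "finite \<Delta>" "\<And>F. F \<in> \<Delta> \<Longrightarrow> finite F" "{} \<in> \<Delta>"
    using cplx by (auto simp: finite_simplicial_complex_def)
  have sd: "partial_sd l \<Delta> = sd_face ` ?K"
    by (rule partial_sd_eq_sd_chains[OF cplx])
  have "({}, {}) \<in> ?K"
    using fin(3) by (auto simp: sd_chains_def chain_subset_def)
  then have "finite (partial_sd l \<Delta>)" "partial_sd l \<Delta> \<noteq> {}"
    unfolding sd using fin by (auto intro: finite_sd_chains)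
  then have "f_poly (partial_sd l \<Delta>) = (\<Sum>G\<in>partial_sd l \<Delta>. [:-1, 1:] ^ (d - card G))"
    by (rule f_poly_as_sum_over_faces) (rule complex_dim_partial_sd[OF assms])
  also have "\<dots> = (\<Sum>p\<in>?K. [:-1, 1:] ^ (d - card (sd_face p)))"
    unfolding sd by (subst sum.reindex) (auto intro: inj_on_subset[OF inj_sd_face])
  also have "\<dots> = (\<Sum>(A, C)\<in>?K. [:-1, 1:] ^ (d - (card A + card C)))"
  proof (rule sum.cong[OF refl], clarify)
    fix A C F assume "F \<in> \<Delta>" "(A, C) \<in> sd_chains l F"
    then show "[:-1, 1:] ^ (d - card (sd_face (A, C))) = ([:-1, 1:] ^ (d - (card A + card C)) :: int poly)"
      using sd_chainsD(1,2)[of A C l F] fin(2) by (simp add: card_sd_face)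
  qed
  also have "\<dots> = (\<Sum>F\<in>\<Delta>. sd_weight d l (card F))"
    by (rule sum_over_chains_with_top_in) (use fin in auto)
  finally show ?thesis .
qed

section \<open>Permutations that sort by a key\<close>

lemma strict_mono_on_from_steps:
  fixes f :: "nat \<Rightarrow> 'b::order"
  assumes step: "\<And>i. 1 \<le> i \<Longrightarrow> i < m \<Longrightarrow> f i < f (Suc i)"
  shows "strict_mono_on {1..m} f"
proof (rule strict_mono_onI)
  fix i j assume ij: "i \<in> {1..m}" "j \<in> {1..m}" "i < j"
  have "i + Suc n \<le> m \<longrightarrow> f i < f (i + Suc n)" for n
    using step ij(1) by (induction n) (auto intro: less_trans)
  from this[of "j - Suc i"] show "f i < f j"
    using ij by simp
qed

text \<open>A sorting permutation puts an element at the position given by its rank. This makes it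
  unique.\<close>

lemma below_sorting_perm:
  fixes key :: "nat \<Rightarrow> 'b::linorder"
  assumes "\<sigma> permutes {1..m}" and "strict_mono_on {1..m} (key \<circ> \<sigma>)" and "i \<in> {1..m}"
  shows "{y \<in> {1..m}. key y < key (\<sigma> i)} = \<sigma> ` {1..<i}"
proof -
  have "key (\<sigma> j) < key (\<sigma> i) \<longleftrightarrow> j < i" if "j \<in> {1..m}" for j
    using strict_mono_on_less[OF assms(2) that assms(3)] by simp
  then have "{y \<in> \<sigma> ` {1..m}. key y < key (\<sigma> i)} = \<sigma> ` {1..<i}"
    using assms(3) by auto
  then show ?thesis
    using permutes_image[OF assms(1)] by simp
qed

lemma sorting_perm_unique:
  fixes key :: "nat \<Rightarrow> 'b::linorder"
  assumes \<sigma>: "\<sigma> permutes {1..m}" "strict_mono_on {1..m} (key \<circ> \<sigma>)"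
    and \<tau>: "\<tau> permutes {1..m}" "strict_mono_on {1..m} (key \<circ> \<tau>)"
  shows "\<sigma> = \<tau>"
proof
  fix i
  show "\<sigma> i = \<tau> i"
  proof (cases "i \<in> {1..m}")
    case True
    then have "\<sigma> i \<in> \<tau> ` {1..m}"
      using permutes_image[OF \<tau>(1)] permutes_in_image[OF \<sigma>(1)] by simp
    then obtain j where j: "j \<in> {1..m}" "\<sigma> i = \<tau> j"
      by auto
    have "card (\<sigma> ` {1..<i}) = card (\<tau> ` {1..<j})"
      using below_sorting_perm[OF \<sigma> True] below_sorting_perm[OF \<tau> j(1)] j(2) by simp
    then have "i - 1 = j - 1"
      using card_image[OF inj_on_subset[OF permutes_inj[OF \<sigma>(1)] subset_UNIV]]
        card_image[OF inj_on_subset[OF permutes_inj[OF \<tau>(1)] subset_UNIV]] by simp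
    then have "i = j"
      using True j(1) unfolding atLeastAtMost_iff by linarith
    then show ?thesis
      using j(2) by simp
  next
    case False
    then show ?thesis
      using \<sigma>(1) \<tau>(1) by (simp add: permutes_not_in)
  qed
qed

lemma ex_sorting_perm:
  fixes key :: "nat \<Rightarrow> 'b::wellorder"
  assumes inj: "inj_on key {1..m}"
  shows "\<exists>\<sigma>. \<sigma> permutes {1..m} \<and> strict_mono_on {1..m} (key \<circ> \<sigma>)"
proof -
  have "card (key ` {1..m}) = m"
    using card_image[OF inj] by simp
  then obtain h where h: "bij_betw h {..<m} (key ` {1..m})" "strict_mono_on {..<m} h"
    using ex_bij_betw_strict_mono_card[of "key ` {1..m}"] by auto
  define \<sigma> where "\<sigma> i = (if i \<in> {1..m} then inv_into {1..m} key (h (i - 1)) else i)" for i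
  have "bij_betw (\<lambda>i. i - 1) {1..m} {..<m}"
    by (rule bij_betw_byWitness[of _ Suc]) auto
  then have "bij_betw (\<lambda>i. inv_into {1..m} key (h (i - 1))) {1..m} {1..m}"
    using bij_betw_trans[OF _ bij_betw_trans[OF h(1)
      bij_betw_inv_into[OF bij_betw_imageI[OF inj refl]]]] by (simp add: comp_def)
  then have "bij_betw \<sigma> {1..m} {1..m}"
    by (rule bij_betw_cong[THEN iffD1, rotated]) (simp add: \<sigma>_def)
  then have "\<sigma> permutes {1..m}"
    by (rule bij_imp_permutes) (auto simp: \<sigma>_def)
  moreover have "key (\<sigma> i) = h (i - 1)" if "i \<in> {1..m}" for i
  proof -
    have "h (i - 1) \<in> key ` {1..m}"
      by (rule bij_betw_apply[OF h(1)]) (use that in auto)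
    then show ?thesis
      using that by (simp add: \<sigma>_def f_inv_into_f)
  qed
  then have "strict_mono_on {1..m} (key \<circ> \<sigma>)"
    by (intro strict_mono_onI) (auto intro!: strict_mono_onD[OF h(2)])
  ultimately show ?thesis by blast
qed

text \<open>The tool for locating the sets of a chain in the word that is built from the chain.\<close>

lemma initial_segment_of_sorting_perm:
  fixes key :: "nat \<Rightarrow> 'b::linorder"
  assumes \<sigma>: "\<sigma> permutes {1..m}" "strict_mono_on {1..m} (key \<circ> \<sigma>)"
    and Y: "Y \<subseteq> {1..m}" "\<And>x y. x \<in> Y \<Longrightarrow> y \<in> {1..m} - Y \<Longrightarrow> key x < key y"
  shows "Y = \<sigma> ` {1..card Y}"
proof (cases "Y = {}")
  case False
  define P where "P = {i \<in> {1..m}. \<sigma> i \<in> Y}"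
  have "Y = \<sigma> ` P"
  proof -
    have "x \<in> \<sigma> ` P" if "x \<in> Y" for x
    proof -
      have "x \<in> \<sigma> ` {1..m}"
        using that Y(1) permutes_image[OF \<sigma>(1)] by auto
      then obtain i where "i \<in> {1..m}" "x = \<sigma> i"
        by blast
      then show ?thesis
        using that by (simp add: P_def)
    qed
    then show ?thesis
      by (auto simp: P_def)
  qed
  then have "P \<noteq> {}" "finite P" "card Y = card P"
    using False card_image[OF inj_on_subset[OF permutes_inj[OF \<sigma>(1)] subset_UNIV], of P]
    by (auto simp: P_def)
  define p where "p = Max P"
  have p: "p \<in> P" "\<And>i. i \<in> P \<Longrightarrow> i \<le> p"
    using \<open>P \<noteq> {}\<close> \<open>finite P\<close> by (auto simp: p_def)
  have "i \<in> P" if "i \<in> {1..p}" for i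
  proof (rule ccontr)
    assume "i \<notin> P"
    have "p \<le> m"
      using p(1) by (simp add: P_def)
    then have "i \<in> {1..m}"
      using that by simp
    moreover have "i \<noteq> p"
      using \<open>i \<notin> P\<close> p(1) by blast
    ultimately have i: "i \<in> {1..m}" "i < p" "\<sigma> i \<notin> Y"
      using that \<open>i \<notin> P\<close> by (simp_all add: P_def)
    then have "key (\<sigma> p) < key (\<sigma> i)"
      using Y(2) p(1) permutes_in_image[OF \<sigma>(1)] by (simp add: P_def)
    moreover have "key (\<sigma> i) < key (\<sigma> p)"
      using strict_mono_onD[OF \<sigma>(2) i(1) _ i(2)] p(1) by (simp add: P_def)
    ultimately show False by simp
  qed
  then have "{1..p} \<subseteq> P"
    by blast
  moreover have "P \<subseteq> {1..p}"
    using p(2) by (simp add: P_def subset_iff)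
  ultimately have "P = {1..p}"
    by (rule equalityI[rotated])
  then have "\<sigma> ` P = \<sigma> ` {1..card Y}"
    using \<open>card Y = card P\<close> by simp
  with \<open>Y = \<sigma> ` P\<close> show ?thesis
    by (rule trans)
qed simp

section \<open>Pairs of a permutation and a superset of its descents versus chains\<close>

text \<open>\<open>L\<close> is the only possible set of the first \<open>l\<close> letters of a word that yields the chain \<open>(A, C)\<close>:
  the set \<open>A\<close>, filled up with the smallest elements of the first block. The first block is the
  smallest set in \<open>C\<close>, or everything if \<open>C\<close> is empty; in both cases it is \<open>{1..m} \<inter> \<Inter>C\<close>.\<close>

definition chain_head :: "nat \<Rightarrow> nat \<Rightarrow> nat set \<Rightarrow> nat set set \<Rightarrow> nat set \<Rightarrow> bool" where
  "chain_head m l A C L \<longleftrightarrow> A \<subseteq> L \<and> L \<subseteq> {1..m} \<inter> \<Inter>C \<and> card L = l \<and>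
     (\<forall>x\<in>L - A. \<forall>y\<in>{1..m} \<inter> \<Inter>C - L. x < y)"

lemma chain_head_unique:
  assumes "chain_head m l A C L" and "chain_head m l A C L'"
  shows "L = L'"
proof (rule ccontr)
  assume "L \<noteq> L'"
  have fin: "finite L" "finite L'" "card L = card L'"
    using assms by (auto simp: chain_head_def intro: finite_subset)
  obtain x where x: "x \<in> L - L'"
    using \<open>L \<noteq> L'\<close> fin by (metis DiffI card_subset_eq subsetI)
  obtain y where y: "y \<in> L' - L"
    using \<open>L \<noteq> L'\<close> fin by (metis DiffI card_subset_eq subsetI)
  let ?R = "{1..m} \<inter> \<Inter>C"
  have L: "A \<subseteq> L" "L \<subseteq> ?R" "\<forall>x\<in>L - A. \<forall>y\<in>?R - L. x < y"
    using assms(1) unfolding chain_head_def by blast+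
  have L': "A \<subseteq> L'" "L' \<subseteq> ?R" "\<forall>x\<in>L' - A. \<forall>y\<in>?R - L'. x < y"
    using assms(2) unfolding chain_head_def by blast+
  have "x \<in> L - A" "x \<in> ?R - L'"
    using x L(2) L'(1) by blast+
  moreover have "y \<in> L' - A" "y \<in> ?R - L"
    using y L(1) L'(2) by blast+
  ultimately have "x < y" "y < x"
    using L(3) L'(3) by blast+
  then show False by simp
qed

text \<open>Enumerate the elements of the first block outside \<open>A\<close> in increasing order and take as many as
  are missing.\<close>

lemma chain_head_exists:
  assumes A: "A \<subseteq> {1..m} \<inter> \<Inter>C" and "card A \<le> l" and "l \<le> card ({1..m} \<inter> \<Inter>C)"
  shows "\<exists>L. chain_head m l A C L"
proof -
  let ?R = "{1..m} \<inter> \<Inter>C" and ?n = "l - card A"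
  have fin: "finite ?R" "finite A"
    using A finite_subset[of A "{1..m}"] by auto
  have n: "?n \<le> card (?R - A)"
    using assms fin by (simp add: card_Diff_subset)
  obtain h where h: "bij_betw h {..<card (?R - A)} (?R - A)" "strict_mono_on {..<card (?R - A)} h"
    using ex_bij_betw_strict_mono_card[of "?R - A"] fin by blast
  have range: "h ` {..<card (?R - A)} = ?R - A" and inj: "inj_on h {..<card (?R - A)}"
    using h(1) by (auto simp: bij_betw_def)
  let ?L = "A \<union> h ` {..<?n}"
  have sub: "h ` {..<?n} \<subseteq> ?R - A"
  proof -
    have "h ` {..<?n} \<subseteq> h ` {..<card (?R - A)}"
      using n by (intro image_mono) simp
    then show ?thesis
      unfolding range .
  qed
  have "card (h ` {..<?n}) = ?n"
    using card_image[OF inj_on_subset[OF inj], of "{..<?n}"] n by simp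
  moreover have "finite (h ` {..<?n})" "A \<inter> h ` {..<?n} = {}"
    using sub by (simp, blast)
  ultimately have "card ?L = l"
    using card_Un_disjoint[OF fin(2), of "h ` {..<?n}"] \<open>card A \<le> l\<close> by simp
  moreover have "x < y" if "x \<in> ?L - A" "y \<in> ?R - ?L" for x y
  proof -
    have "x \<in> h ` {..<?n}"
      using that(1) by blast
    moreover have "y \<in> h ` {..<card (?R - A)}"
      unfolding range using that(2) by blast
    ultimately obtain i j where "x = h i" "i < ?n" "y = h j" "j < card (?R - A)"
      by auto
    moreover from this have "?n \<le> j"
      using that(2) by (metis DiffE UnI2 imageI lessThan_iff not_le)
    ultimately show ?thesis
      using strict_mono_onD[OF h(2), of i j] by simp
  qed
  moreover have "?L \<subseteq> ?R"
    using A sub by blast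
  ultimately have "chain_head m l A C ?L"
    unfolding chain_head_def by blast
  then show ?thesis by blast
qed

text \<open>Sorting lexicographically by this key produces the word of the chain \<open>(A, C)\<close> from the set \<open>L\<close> of
  its first \<open>l\<close> letters. Elements of \<open>L\<close> come first and in decreasing order. For the others, the
  number of sets in \<open>C\<close> that miss \<open>x\<close> is the index of the block of \<open>x\<close>, and each block is
  increasing.\<close>

definition chain_key :: "nat \<Rightarrow> nat set \<Rightarrow> nat set set \<Rightarrow> nat \<Rightarrow> nat \<times> nat" where
  "chain_key m L C x = (if x \<in> L then (0, m - x) else (Suc (card {B \<in> C. x \<notin> B}), x))"

lemma inj_on_chain_key: "inj_on (chain_key m L C) {1..m}"
  by (rule inj_onI) (auto simp: chain_key_def split: if_splits)

definition perm_pairs :: "nat \<Rightarrow> nat \<Rightarrow> ((nat \<Rightarrow> nat) \<times> nat set) set" where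
  "perm_pairs m l = {(\<sigma>, T). \<sigma> \<in> S_perms m l \<and> descent_set m l \<sigma> \<subseteq> T \<and> T \<subseteq> {1..m-1}}"

text \<open>Every \<open>t > l\<close> in \<open>T\<close> gives a set of \<open>t\<close> letters, whereas an \<open>i \<le> l\<close> in \<open>T\<close> only selects a
  single letter for \<open>A\<^sub>0\<close>. So the chain has \<open>card T\<close> vertices when viewed as a face.\<close>

definition perm_chain :: "nat \<Rightarrow> (nat \<Rightarrow> nat) \<times> nat set \<Rightarrow> nat set \<times> nat set set" where
  "perm_chain l = (\<lambda>(\<sigma>, T). (\<sigma> ` (T \<inter> {1..l}), (\<lambda>t. \<sigma> ` {1..t}) ` (T - {1..l})))"

lemma perm_pair_permutes:
  assumes pair: "(\<sigma>, T) \<in> perm_pairs m l"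
  shows "\<sigma> permutes {1..m}"
  using pair by (simp add: perm_pairs_def S_perms_def)

lemma perm_pair_mem_iff:
  assumes pair: "(\<sigma>, T) \<in> perm_pairs m l"
  shows "\<sigma> i \<in> \<sigma> ` X \<longleftrightarrow> i \<in> X"
  using permutes_inj[OF perm_pair_permutes[OF pair]] by (simp add: inj_image_mem_iff)

lemma perm_pair_card_image:
  assumes pair: "(\<sigma>, T) \<in> perm_pairs m l"
  shows "card (\<sigma> ` X) = card X"
  using permutes_inj[OF perm_pair_permutes[OF pair]] by (meson card_image inj_on_subset subset_UNIV)

lemma perm_pair_T:
  assumes pair: "(\<sigma>, T) \<in> perm_pairs m l"
  shows "T \<subseteq> {1..m-1}" "finite T"
  using pair finite_subset by (auto simp: perm_pairs_def)

lemma perm_pair_A: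
  assumes AC: "perm_chain l (\<sigma>, T) = (A, C)"
  shows "A = \<sigma> ` (T \<inter> {1..l})"
  using AC by (simp add: perm_chain_def)

lemma perm_pair_C:
  assumes AC: "perm_chain l (\<sigma>, T) = (A, C)"
  shows "C = (\<lambda>t. \<sigma> ` {1..t}) ` (T - {1..l})"
  using AC by (simp add: perm_chain_def)

lemma perm_pair_memberE:
  assumes pair: "(\<sigma>, T) \<in> perm_pairs m l" and AC: "perm_chain l (\<sigma>, T) = (A, C)" and "B \<in> C"
  obtains t where "t \<in> T" "l < t" "t < m" "B = \<sigma> ` {1..t}"
proof -
  obtain t where t: "t \<in> T" "t \<notin> {1..l}" "B = \<sigma> ` {1..t}"
    using \<open>B \<in> C\<close> unfolding perm_pair_C[OF AC] by blast
  then have "t \<in> {1..m-1}"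
    using perm_pair_T(1)[OF pair] by blast
  then have "l < t" "t < m"
    using t(2) by auto
  then show thesis
    using t that by blast
qed

lemma perm_pair_inj_on_blocks:
  assumes pair: "(\<sigma>, T) \<in> perm_pairs m l"
  shows "inj_on (\<lambda>t. \<sigma> ` {1..t}) X"
  by (rule inj_onI) (metis perm_pair_card_image[OF pair] card_atLeastAtMost diff_Suc_1)

text \<open>A position outside \<open>T\<close> is no descent, and the inequalities are strict because \<open>\<sigma>\<close> is
  injective.\<close>

lemma perm_pair_nondescent:
  assumes pair: "(\<sigma>, T) \<in> perm_pairs m l"
    and "1 \<le> i" and "i < m" and "i \<notin> T"
  shows "i \<le> l \<Longrightarrow> \<sigma> i < \<sigma> (Suc l)" and "l < i \<Longrightarrow> \<sigma> i < \<sigma> (Suc i)"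
proof -
  have "i \<notin> descent_set m l \<sigma>"
    using pair assms by (auto simp: perm_pairs_def)
  then have "i \<le> l \<Longrightarrow> \<sigma> i \<le> \<sigma> (Suc l)" "l < i \<Longrightarrow> \<sigma> i \<le> \<sigma> (Suc i)"
    using assms by (auto simp: descent_set_def)
  moreover have "\<sigma> i \<noteq> \<sigma> j" if "i \<noteq> j" for j
    using permutes_inj[OF perm_pair_permutes[OF pair]] that by (auto dest: injD)
  ultimately show "i \<le> l \<Longrightarrow> \<sigma> i < \<sigma> (Suc l)" "l < i \<Longrightarrow> \<sigma> i < \<sigma> (Suc i)"
    by (metis le_neq_implies_less less_irrefl_nat less_Suc_eq_le, metis le_neq_implies_less n_not_Suc_n)
qed

lemma perm_pair_level:
  assumes pair: "(\<sigma>, T) \<in> perm_pairs m l" and AC: "perm_chain l (\<sigma>, T) = (A, C)"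
    and "1 \<le> i"
  shows "card {B \<in> C. \<sigma> i \<notin> B} = card {t \<in> T. l < t \<and> t < i}"
proof -
  have "{B \<in> C. \<sigma> i \<notin> B} = (\<lambda>t. \<sigma> ` {1..t}) ` {t \<in> T. l < t \<and> t < i}"
  proof -
    have mem: "\<sigma> i \<in> \<sigma> ` {1..t} \<longleftrightarrow> i \<le> t" for t
      using assms by (simp add: perm_pair_mem_iff[OF pair])
    have "{B \<in> C. \<sigma> i \<notin> B} = (\<lambda>t. \<sigma> ` {1..t}) ` {t \<in> T - {1..l}. \<sigma> i \<notin> \<sigma> ` {1..t}}"
      unfolding perm_pair_C[OF AC] by (rule Compr_image_eq)
    also have "{t \<in> T - {1..l}. \<sigma> i \<notin> \<sigma> ` {1..t}} = {t \<in> T. l < t \<and> t < i}"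
      unfolding mem using perm_pair_T(1)[OF pair] by (auto simp: not_le)
    finally show ?thesis .
  qed
  then show ?thesis
    by (simp only: card_image[OF perm_pair_inj_on_blocks[OF pair]])
qed

text \<open>A step from \<open>i\<close> to \<open>i + 1\<close> stays within the first \<open>l\<close> letters, leaves them, enters a new block
  (\<open>i \<in> T\<close>), or stays within a block (\<open>i \<notin> T\<close>). The key increases in each case.\<close>

lemma perm_pair_sorted:
  assumes pair: "(\<sigma>, T) \<in> perm_pairs m l" and AC: "perm_chain l (\<sigma>, T) = (A, C)"
  shows "strict_mono_on {1..m} (chain_key m (\<sigma> ` {1..l}) C \<circ> \<sigma>)"
proof (rule strict_mono_on_from_steps)
  fix i assume i: "1 \<le> i" "i < m"
  have range: "\<sigma> i \<in> {1..m}"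
    using i permutes_in_image[OF perm_pair_permutes[OF pair]] by simp
  consider "Suc i \<le> l" | "i = l" | "l < i" "i \<in> T" | "l < i" "i \<notin> T"
    by linarith
  then show "(chain_key m (\<sigma> ` {1..l}) C \<circ> \<sigma>) i < (chain_key m (\<sigma> ` {1..l}) C \<circ> \<sigma>) (Suc i)"
  proof cases
    case 1
    have "strict_antimono_on {1..l} \<sigma>"
      using pair by (simp add: perm_pairs_def S_perms_def)
    then have "\<sigma> (Suc i) < \<sigma> i"
      using monotone_onD[of "{1..l}" "(<)" "(>)" \<sigma> i "Suc i"] 1 i by simp
    then show ?thesis
      using 1 i range by (auto simp: chain_key_def perm_pair_mem_iff[OF pair])
  next
    case 2
    then show ?thesis
      using i by (auto simp: chain_key_def perm_pair_mem_iff[OF pair])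
  next
    case 3
    have "{t \<in> T. l < t \<and> t < i} \<subset> {t \<in> T. l < t \<and> t < Suc i}"
      using 3 by auto
    then have "card {t \<in> T. l < t \<and> t < i} < card {t \<in> T. l < t \<and> t < Suc i}"
      using perm_pair_T(2)[OF pair] by (intro psubset_card_mono) auto
    then show ?thesis
      using 3 i by (auto simp: chain_key_def perm_pair_mem_iff[OF pair] perm_pair_level[OF pair AC])
  next
    case 4
    have "{t \<in> T. l < t \<and> t < i} = {t \<in> T. l < t \<and> t < Suc i}"
      using 4 by (auto simp: less_Suc_eq)
    then show ?thesis
      using 4 i perm_pair_nondescent(2)[OF pair i]
      by (auto simp: chain_key_def perm_pair_mem_iff[OF pair] perm_pair_level[OF pair AC])
  qed
qed

lemma perm_pair_same_level:
  assumes pair: "(\<sigma>, T) \<in> perm_pairs m l" and AC: "perm_chain l (\<sigma>, T) = (A, C)"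
    and "l < i" and "i \<le> j" and "j \<le> m" and "{B \<in> C. \<sigma> i \<notin> B} = {B \<in> C. \<sigma> j \<notin> B}"
  shows "\<sigma> i \<le> \<sigma> j"
proof (cases "i = j")
  case False
  then have "chain_key m (\<sigma> ` {1..l}) C (\<sigma> i) < chain_key m (\<sigma> ` {1..l}) C (\<sigma> j)"
    using assms strict_mono_onD[OF perm_pair_sorted[OF pair AC], of i j] by simp
  then show ?thesis
    using assms by (auto simp: chain_key_def perm_pair_mem_iff[OF pair])
qed simp

text \<open>A letter among the first \<open>l\<close> that is not selected for \<open>A\<close> is smaller than the letter at \<open>l + 1\<close>,
  and that one is the smallest of the remaining letters of the first block.\<close>

lemma perm_pair_head:
  assumes l: "l < m" and pair: "(\<sigma>, T) \<in> perm_pairs m l"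
    and AC: "perm_chain l (\<sigma>, T) = (A, C)"
  shows "chain_head m l A C (\<sigma> ` {1..l})"
proof -
  let ?L = "\<sigma> ` {1..l}"
  have initial: "\<sigma> ` {1..i} \<subseteq> B" if "i \<le> Suc l" "B \<in> C" for i B
  proof -
    obtain t where "t \<in> T" "l < t" "t < m" "B = \<sigma> ` {1..t}"
      by (rule perm_pair_memberE[OF pair AC \<open>B \<in> C\<close>])
    moreover have "{1..i} \<subseteq> {1..t}"
      using \<open>i \<le> Suc l\<close> \<open>l < t\<close> by simp
    ultimately show ?thesis
      by (simp only: image_mono)
  qed
  have "?L \<subseteq> \<sigma> ` {1..m}"
    using l by (intro image_mono) simp
  then have "?L \<subseteq> {1..m}"
    unfolding permutes_image[OF perm_pair_permutes[OF pair]] .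
  moreover have "?L \<subseteq> \<Inter>C"
    by (rule Inter_greatest) (rule initial, simp)
  ultimately have "?L \<subseteq> {1..m} \<inter> \<Inter>C"
    by (rule Int_greatest)
  moreover have "x < y" if x: "x \<in> ?L - A" and y: "y \<in> {1..m} \<inter> \<Inter>C - ?L" for x y
  proof -
    obtain i where i: "x = \<sigma> i" "i \<in> {1..l}" "i \<notin> T"
      using x by (auto simp: perm_pair_A[OF AC] perm_pair_mem_iff[OF pair])
    have "y \<in> \<sigma> ` {1..m}"
      using y permutes_image[OF perm_pair_permutes[OF pair]] by simp
    then obtain j where j: "y = \<sigma> j" "j \<in> {1..m}"
      by blast
    moreover have "j \<notin> {1..l}"
      using y j(1) by blast
    ultimately have "l < j"
      by simp
    have "\<sigma> i < \<sigma> (Suc l)"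
      using perm_pair_nondescent(1)[OF pair] i l by auto
    also have "\<sigma> (Suc l) \<in> B" if "B \<in> C" for B
      using initial[of "Suc l" B] that by auto
    then have "\<sigma> (Suc l) \<le> \<sigma> j"
      using j y \<open>l < j\<close> by (intro perm_pair_same_level[OF pair AC]) auto
    finally show ?thesis
      using i j by simp
  qed
  moreover have "A \<subseteq> ?L"
    unfolding perm_pair_A[OF AC] by (rule image_mono) (rule Int_lower2)
  moreover have "card ?L = l"
    unfolding perm_pair_card_image[OF pair] by simp
  ultimately show ?thesis
    unfolding chain_head_def by blast
qed

lemma perm_pair_cards:
  assumes pair: "(\<sigma>, T) \<in> perm_pairs m l" and AC: "perm_chain l (\<sigma>, T) = (A, C)"
  shows "card A + card C = card T"
proof -
  have "card A + card C = card (T \<inter> {1..l}) + card (T - {1..l})"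
    unfolding perm_pair_A[OF AC] perm_pair_C[OF AC] perm_pair_card_image[OF pair]
      card_image[OF perm_pair_inj_on_blocks[OF pair]] ..
  then show ?thesis
    using card_Int_Diff[OF perm_pair_T(2)[OF pair]] by simp
qed

lemma perm_pair_recover:
  assumes pair: "(\<sigma>, T) \<in> perm_pairs m l" and AC: "perm_chain l (\<sigma>, T) = (A, C)"
  shows "T = {i \<in> {1..l}. \<sigma> i \<in> A} \<union> card ` C"
proof -
  have "card ` C = T - {1..l}"
    by (simp add: perm_pair_C[OF AC] image_image perm_pair_card_image[OF pair])
  moreover have "{i \<in> {1..l}. \<sigma> i \<in> A} = T \<inter> {1..l}"
    unfolding perm_pair_A[OF AC] perm_pair_mem_iff[OF pair] by blast
  ultimately show ?thesis
    by blast
qed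

lemma perm_pair_chain:
  assumes pair: "(\<sigma>, T) \<in> perm_pairs m l" and AC: "perm_chain l (\<sigma>, T) = (A, C)"
  shows "(A, C) \<in> sd_chains l (A \<union> \<Union>C)"
proof -
  have "chain\<^sub>\<subseteq> C"
    unfolding perm_pair_C[OF AC] by (auto simp: chain_subset_def intro!: image_mono)
  moreover have "A \<subseteq> B \<and> l < card B" if "B \<in> C" for B
  proof -
    obtain t where "t \<in> T" "l < t" "t < m" "B = \<sigma> ` {1..t}"
      by (rule perm_pair_memberE[OF pair AC \<open>B \<in> C\<close>])
    moreover from this have "T \<inter> {1..l} \<subseteq> {1..t}"
      by auto
    ultimately show ?thesis
      by (simp add: perm_pair_A[OF AC] perm_pair_card_image[OF pair] image_mono)
  qed
  moreover have "card A \<le> card {1..l}"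
    unfolding perm_pair_A[OF AC] perm_pair_card_image[OF pair] by (rule card_mono) auto
  ultimately show ?thesis
    by (simp add: sd_chains_def)
qed

text \<open>The last letter is the largest element outside the largest set \<open>A \<union> \<Union>C\<close>. If \<open>C\<close> is
  nonempty, the elements outside form the last block, which is increasing. If \<open>C\<close> is empty, there is
  just one block: its letters after the first \<open>l\<close> are increasing, and those of the first \<open>l\<close> letters
  that are not in \<open>A\<close> are smaller than the letter at \<open>l + 1\<close>.\<close>

lemma perm_pair_top:
  assumes l: "l < m" and pair: "(\<sigma>, T) \<in> perm_pairs m l"
    and AC: "perm_chain l (\<sigma>, T) = (A, C)"
  shows "{\<sigma> m<..m} \<subseteq> A \<union> \<Union>C" "A \<union> \<Union>C \<subseteq> {1..m} - {\<sigma> m}"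
proof -
  have img: "\<sigma> ` {1..m} = {1..m}"
    by (rule permutes_image[OF perm_pair_permutes[OF pair]])
  have "T \<inter> {1..l} \<subseteq> {1..m}" "\<And>t. t \<in> T \<Longrightarrow> {1..t} \<subseteq> {1..m}"
    using l perm_pair_T(1)[OF pair] by fastforce+
  then have "\<sigma> ` (T \<inter> {1..l}) \<subseteq> \<sigma> ` {1..m}" "\<And>t. t \<in> T \<Longrightarrow> \<sigma> ` {1..t} \<subseteq> \<sigma> ` {1..m}"
    by (simp_all add: image_mono)
  then have "A \<union> \<Union>C \<subseteq> {1..m}"
    unfolding img perm_pair_A[OF AC] perm_pair_C[OF AC] by blast
  moreover have m: "\<sigma> m \<notin> A \<union> \<Union>C"
    using l perm_pair_T(1)[OF pair]
    by (auto simp: perm_pair_A[OF AC] perm_pair_C[OF AC] perm_pair_mem_iff[OF pair])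
  ultimately show "A \<union> \<Union>C \<subseteq> {1..m} - {\<sigma> m}"
    by blast
  show "{\<sigma> m<..m} \<subseteq> A \<union> \<Union>C"
  proof
    fix x assume x: "x \<in> {\<sigma> m<..m}"
    then have "x \<in> \<sigma> ` {1..m}"
      unfolding img by auto
    then obtain i where i: "x = \<sigma> i" "i \<in> {1..m}"
      by auto
    show "x \<in> A \<union> \<Union>C"
    proof (rule ccontr)
      assume out: "x \<notin> A \<union> \<Union>C"
      show False
      proof (cases "i \<le> l")
        case True
        then have "i \<notin> T"
          using out i by (auto simp: perm_pair_A[OF AC])
        then have "\<sigma> i < \<sigma> (Suc l)"
          using perm_pair_nondescent(1)[OF pair] i True l by auto
        also have "T - {1..l} = {}"
        proof (rule ccontr)
          assume "T - {1..l} \<noteq> {}"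
          then obtain t where t: "t \<in> T - {1..l}"
            by blast
          then have "i \<in> {1..t}"
            using True i(2) perm_pair_T(1)[OF pair] by auto
          then have "x \<in> \<Union>C"
            unfolding perm_pair_C[OF AC] i(1) using t by blast
          then show False
            using out by simp
        qed
        then have "C = {}"
          by (simp add: perm_pair_C[OF AC])
        then have "\<sigma> (Suc l) \<le> \<sigma> m"
          using l by (intro perm_pair_same_level[OF pair AC]) auto
        finally show False
          using x i by simp
      next
        case False
        then have "\<sigma> i \<le> \<sigma> m"
          using out i m by (intro perm_pair_same_level[OF pair AC]) auto
        then show False
          using x i by simp
      qed
    qed
  qed
qed

text \<open>The chain determines the set of the first \<open>l\<close> letters, hence the key, hence the permutation that
  sorts by it; finally \<open>T\<close> is read off from \<open>\<sigma>\<close> and the chain.\<close>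

lemma inj_on_perm_chain:
  assumes l: "l < m"
  shows "inj_on (perm_chain l) (perm_pairs m l)"
proof (rule inj_onI; clarify)
  fix \<sigma> T \<tau> U
  assume \<sigma>: "(\<sigma>, T) \<in> perm_pairs m l" and \<tau>: "(\<tau>, U) \<in> perm_pairs m l"
    and eq: "perm_chain l (\<sigma>, T) = perm_chain l (\<tau>, U)"
  obtain A C where AC: "perm_chain l (\<sigma>, T) = (A, C)" "perm_chain l (\<tau>, U) = (A, C)"
    using eq by (cases "perm_chain l (\<tau>, U)") auto
  have "\<sigma> ` {1..l} = \<tau> ` {1..l}"
    by (rule chain_head_unique[OF perm_pair_head[OF l \<sigma> AC(1)] perm_pair_head[OF l \<tau> AC(2)]])
  then have "\<sigma> = \<tau>"
    using sorting_perm_unique[OF perm_pair_permutes[OF \<sigma>] perm_pair_sorted[OF \<sigma> AC(1)]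
        perm_pair_permutes[OF \<tau>]] perm_pair_sorted[OF \<tau> AC(2)] by simp
  then show "\<sigma> = \<tau> \<and> T = U"
    using perm_pair_recover[OF \<sigma> AC(1)] perm_pair_recover[OF \<tau> AC(2)] by simp
qed

text \<open>The preimage sorts \<open>{1..m}\<close> by the key of the chain. The set \<open>L\<close> of \<open>chain_head\<close>, the first
  block and every set of the chain are then initial segments of the word, and a descent outside \<open>T\<close>
  would contradict the order of the keys. The inclusion \<open>F \<subset> {1..m}\<close> is strict because \<open>T\<close> must
  not contain \<open>m\<close>.\<close>

lemma perm_chain_surj:
  assumes l: "l < m" and ch: "(A, C) \<in> sd_chains l F" and F: "F \<subset> {1..m}"
  shows "\<exists>p\<in>perm_pairs m l. perm_chain l p = (A, C)"
proof -
  have "finite F"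
    using F by (meson finite_atLeastAtMost finite_subset psubset_imp_subset)
  note D = sd_chainsD[OF ch this]
  let ?R = "{1..m} \<inter> \<Inter>C"
  have "l < card ?R"
  proof (cases "C = {}")
    case False
    have "\<Inter>C \<in> C"
      using Inter_in_chain[OF D(2) False] ch by (auto simp: sd_chains_def chain_subset_alt_def)
    moreover from this have "?R = \<Inter>C"
      using D(4) F by blast
    ultimately show ?thesis
      using D(9) by simp
  qed (use l in simp)
  moreover have A: "A \<subseteq> ?R"
    using D(3,8) F by blast
  ultimately obtain L where L: "chain_head m l A C L"
    using chain_head_exists[of A m C l] D(7) by auto
  let ?key = "chain_key m L C"
  obtain \<sigma> where \<sigma>: "\<sigma> permutes {1..m}" "strict_mono_on {1..m} (?key \<circ> \<sigma>)"
    using ex_sorting_perm[OF inj_on_chain_key] by blast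
  note inj = permutes_inj[OF \<sigma>(1)]
  have less_key: "?key (\<sigma> i) < ?key (\<sigma> j)" if "1 \<le> i" "i < j" "j \<le> m" for i j
    using strict_mono_onD[OF \<sigma>(2), of i j] that by simp
  have range: "\<sigma> i \<in> {1..m}" if "i \<in> {1..m}" for i
    using that permutes_in_image[OF \<sigma>(1)] by simp
  have L': "A \<subseteq> L" "L \<subseteq> ?R" "card L = l" "\<And>x y. x \<in> L - A \<Longrightarrow> y \<in> ?R - L \<Longrightarrow> x < y"
    using L by (auto simp: chain_head_def)
  have level0: "?key x = (Suc 0, x)" if "x \<in> ?R - L" for x
  proof -
    have "{B \<in> C. x \<notin> B} = {}"
      using that by auto
    then show ?thesis
      using that unfolding chain_key_def by (metis DiffE card.empty)
  qed
  have level_pos: "Suc 0 < fst (?key x)" if "x \<notin> \<Inter>C" for x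
    using that L'(2) D(2) by (auto simp: chain_key_def card_gt_0_iff)
  have L_eq: "L = \<sigma> ` {1..l}"
    using initial_segment_of_sorting_perm[OF \<sigma>, of L] L'(2,3) by (auto simp: chain_key_def)
  have "?R = \<sigma> ` {1..card ?R}"
  proof (rule initial_segment_of_sorting_perm[OF \<sigma>])
    fix x y assume "x \<in> ?R" "y \<in> {1..m} - ?R"
    then show "?key x < ?key y"
      using level0[of x] level_pos[of y] by (cases "x \<in> L"; cases "?key y") (auto simp: chain_key_def)
  qed auto
  then have "\<sigma> (Suc l) \<in> ?R"
    using \<open>l < card ?R\<close> by (metis Suc_leI atLeastAtMost_iff image_eqI le_add1 plus_1_eq_Suc)
  moreover have "\<sigma> (Suc l) \<notin> L"
    unfolding L_eq using inj by (simp add: inj_image_mem_iff)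
  \<comment> \<open>The position \<open>l + 1\<close> still lies in the first block, so its letter bounds \<open>L - A\<close> from above.\<close>
  ultimately have next_entry: "\<sigma> (Suc l) \<in> ?R - L"
    by simp
  have C_eq: "B = \<sigma> ` {1..card B}" if "B \<in> C" for B
  proof (rule initial_segment_of_sorting_perm[OF \<sigma>])
    show "B \<subseteq> {1..m}"
      using D(4)[OF that] F by auto
    fix x y assume xy: "x \<in> B" "y \<in> {1..m} - B"
    have "{B' \<in> C. x \<notin> B'} \<subset> {B' \<in> C. y \<notin> B'}"
      using xy D(6)[OF that] that by blast
    then have "card {B' \<in> C. x \<notin> B'} < card {B' \<in> C. y \<notin> B'}"
      using D(2) by (intro psubset_card_mono) auto
    moreover have "y \<notin> L"
      using xy L'(2) that by auto
    ultimately show "?key x < ?key y"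
      by (auto simp: chain_key_def)
  qed
  have card_C: "card B \<in> {1..m-1} - {1..l}" if "B \<in> C" for B
  proof -
    have "card B < card {1..m}"
      using D(4)[OF that] F by (intro psubset_card_mono) auto
    then show ?thesis
      using D(9)[OF that] by simp
  qed
  define T where "T = {i \<in> {1..l}. \<sigma> i \<in> A} \<union> card ` C"
  have "\<sigma> j < \<sigma> i" if "i \<in> {1..l}" "j \<in> {1..l}" "i < j" for i j
  proof -
    have "\<sigma> i \<in> L" "\<sigma> j \<in> L"
      using that by (auto simp: L_eq)
    then show ?thesis
      using less_key[of i j] range[of i] that l by (auto simp: chain_key_def)
  qed
  then have "\<sigma> \<in> S_perms m l"
    using \<sigma>(1) by (auto simp: S_perms_def monotone_on_def)
  moreover have "i \<in> T" if "i \<in> descent_set m l \<sigma>" for i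
  proof (cases "i \<le> l")
    case True
    then have i: "i \<in> {1..l}" "\<sigma> (Suc l) < \<sigma> i"
      using that by (auto simp: descent_set_def)
    then have "\<sigma> i \<in> L"
      by (auto simp: L_eq)
    then have "\<sigma> i \<in> A"
      using L'(4)[OF _ next_entry, of "\<sigma> i"] i(2) by auto
    then show ?thesis
      using i by (simp add: T_def)
  next
    case False
    then have i: "l < i" "i < m" "\<sigma> (Suc i) < \<sigma> i"
      using that by (auto simp: descent_set_def)
    then have "\<sigma> i \<notin> L" "\<sigma> (Suc i) \<notin> L"
      using inj by (auto simp: L_eq inj_image_mem_iff)
    then have "card {B \<in> C. \<sigma> i \<notin> B} < card {B \<in> C. \<sigma> (Suc i) \<notin> B}"
      using less_key[of i "Suc i"] i by (auto simp: chain_key_def)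
    \<comment> \<open>A descent forces a change of block, so some set of the chain ends exactly at \<open>i\<close>.\<close>
    then have "\<not> {B \<in> C. \<sigma> (Suc i) \<notin> B} \<subseteq> {B \<in> C. \<sigma> i \<notin> B}"
      using card_mono[of "{B \<in> C. \<sigma> i \<notin> B}" "{B \<in> C. \<sigma> (Suc i) \<notin> B}"] D(2) by auto
    then obtain B where B: "B \<in> C" "\<sigma> i \<in> B" "\<sigma> (Suc i) \<notin> B"
      by auto
    then have "i \<in> {1..card B}" "Suc i \<notin> {1..card B}"
      using C_eq[OF B(1)] inj by (metis inj_image_mem_iff)+
    then have "card B = i"
      by simp
    then show ?thesis
      using B(1) by (auto simp: T_def)
  qed
  moreover have "T \<subseteq> {1..m-1}"
    using card_C l by (auto simp: T_def)
  ultimately have "(\<sigma>, T) \<in> perm_pairs m l"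
    by (auto simp: perm_pairs_def)
  moreover have "perm_chain l (\<sigma>, T) = (A, C)"
  proof -
    have "T \<inter> {1..l} = {i \<in> {1..l}. \<sigma> i \<in> A}" "T - {1..l} = card ` C"
      using card_C by (auto simp: T_def)
    moreover have "\<sigma> ` {i \<in> {1..l}. \<sigma> i \<in> A} = A"
      using L'(1) by (auto simp: L_eq)
    moreover have "(\<lambda>t. \<sigma> ` {1..t}) ` card ` C = C"
      using C_eq by (simp add: image_image)
    ultimately show ?thesis
      by (simp add: perm_chain_def)
  qed
  ultimately show ?thesis by blast
qed

text \<open>By \<open>perm_pair_top\<close> the last letter can be read off from the largest set \<open>F\<close> of the chain; the
  interval on the right consists of the sets \<open>F\<close> for which it is \<open>k\<close>.\<close>

lemma perm_chain_size_preserving_bij: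
  assumes l: "l < m" and k: "k \<in> {1..m}"
  shows "bij_betw (perm_chain l) {(\<sigma>, T) \<in> perm_pairs m l. \<sigma> m = k}
      (\<Union>F\<in>{{k<..m}..{1..m} - {k}}. sd_chains l F) \<and>
    (\<forall>(\<sigma>, T)\<in>perm_pairs m l. \<forall>A C. perm_chain l (\<sigma>, T) = (A, C) \<longrightarrow> card A + card C = card T)"
  unfolding bij_betw_def
proof (intro conjI equalityI subsetI)
  show "\<forall>(\<sigma>, T)\<in>perm_pairs m l. \<forall>A C. perm_chain l (\<sigma>, T) = (A, C) \<longrightarrow> card A + card C = card T"
    using perm_pair_cards by blast
next
  show "inj_on (perm_chain l) {(\<sigma>, T) \<in> perm_pairs m l. \<sigma> m = k}"
    by (rule inj_on_subset[OF inj_on_perm_chain[OF l]]) auto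
next
  fix q assume "q \<in> perm_chain l ` {(\<sigma>, T) \<in> perm_pairs m l. \<sigma> m = k}"
  then obtain \<sigma> T where p: "(\<sigma>, T) \<in> perm_pairs m l" "\<sigma> m = k" "perm_chain l (\<sigma>, T) = q"
    by auto
  obtain A C where q: "q = (A, C)"
    by fastforce
  show "q \<in> (\<Union>F\<in>{{k<..m}..{1..m} - {k}}. sd_chains l F)"
    using perm_pair_chain[OF p(1) p(3)[unfolded q]] perm_pair_top[OF l p(1) p(3)[unfolded q]]
    unfolding q p(2) by (intro UN_I[of "A \<union> \<Union>C"]) simp_all
next
  fix q assume q_in: "q \<in> (\<Union>F\<in>{{k<..m}..{1..m} - {k}}. sd_chains l F)"
  obtain A C where "q = (A, C)"
    by fastforce
  from q_in obtain F where "F \<in> {{k<..m}..{1..m} - {k}}" "q \<in> sd_chains l F"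
    by (rule UN_E)
  with \<open>q = (A, C)\<close>
  have q: "q = (A, C)" "(A, C) \<in> sd_chains l F" "{k<..m} \<subseteq> F" "F \<subseteq> {1..m} - {k}"
    by simp_all
  have F: "F = A \<union> \<Union>C"
    using q(2) by (simp add: sd_chains_def)
  have "F \<subset> {1..m}"
    using q(4) k by blast
  then obtain \<sigma> T where p: "(\<sigma>, T) \<in> perm_pairs m l" "perm_chain l (\<sigma>, T) = (A, C)"
    using perm_chain_surj[OF l q(2)] by fastforce
  have "\<sigma> m \<in> {1..m}"
    using permutes_in_image[OF perm_pair_permutes[OF p(1)]] k by simp
  moreover have "{\<sigma> m<..m} \<subseteq> F" "F \<subseteq> {1..m} - {\<sigma> m}"
    using perm_pair_top[OF l p] F by auto
  ultimately have "\<sigma> m = k"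
    using q(3,4) k by (metis DiffE atLeastAtMost_iff greaterThanAtMost_iff insertI1 linorder_neqE_nat subsetD)
  then show "q \<in> perm_chain l ` {(\<sigma>, T) \<in> perm_pairs m l. \<sigma> m = k}"
    using p q(1) by force
qed

section \<open>The h-vector of the subdivision\<close>

lemma sum_weights_eq_sum_perms:
  assumes "l < d + 1" and "k \<in> {1..d+1}"
  shows "(\<Sum>F\<in>{{k<..d+1}..{1..d+1} - {k}}. sd_weight d l (card F)) =
    (\<Sum>\<sigma> | \<sigma> \<in> S_perms (d+1) l \<and> \<sigma> (d+1) = k. monom 1 (d - des (d+1) l \<sigma>))"
proof -
  let ?y = "[:-1, 1:] :: int poly"
  let ?I = "{{k<..d+1}..{1..d+1} - {k}}"
  let ?S = "{\<sigma>. \<sigma> \<in> S_perms (d+1) l \<and> \<sigma> (d+1) = k}"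
  let ?T = "\<lambda>\<sigma>. {descent_set (d+1) l \<sigma>..{1..d}}"
  have fin_T: "finite (?T \<sigma>)" for \<sigma>
    by (simp add: finite_set_interval)
  have fin_S: "finite ?S"
    by (rule finite_subset[OF _ finite_permutations[of "{1..d+1}"]]) (auto simp: S_perms_def)
  have fin_I: "finite ?I" "\<And>F. F \<in> ?I \<Longrightarrow> finite F"
    by (simp_all add: finite_set_interval finite_subset[of _ "{1..d+1} - {k}"])
  note perm_chain_size_preserving_bij[OF assms]
  then have bij: "bij_betw (perm_chain l) {(\<sigma>, T) \<in> perm_pairs (d+1) l. \<sigma> (d+1) = k}
      (\<Union>F\<in>?I. sd_chains l F)"
    and cards: "\<And>\<sigma> T A C. (\<sigma>, T) \<in> perm_pairs (d+1) l \<Longrightarrow> perm_chain l (\<sigma>, T) = (A, C) \<Longrightarrow>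
      card A + card C = card T"
    by (rule conjunct1, blast)
  have pairs: "{(\<sigma>, T) \<in> perm_pairs (d+1) l. \<sigma> (d+1) = k} = Sigma ?S ?T"
    by (simp add: set_eq_iff perm_pairs_def conj_ac)
  have "(\<Sum>F\<in>?I. sd_weight d l (card F)) =
      (\<Sum>(A, C)\<in>(\<Union>F\<in>?I. sd_chains l F). ?y ^ (d - (card A + card C)))"
    using sum_over_chains_with_top_in[OF fin_I] by (rule sym)
  also have "\<dots> = (\<Sum>p\<in>Sigma ?S ?T. case perm_chain l p of (A, C) \<Rightarrow> ?y ^ (d - (card A + card C)))"
    using sum.reindex_bij_betw[OF bij, symmetric] unfolding pairs .
  also have "\<dots> = (\<Sum>(\<sigma>, T)\<in>Sigma ?S ?T. ?y ^ (d - card T))"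
  proof (rule sum.cong[OF refl])
    fix p assume p: "p \<in> Sigma ?S ?T"
    obtain \<sigma> T A C where eqs: "p = (\<sigma>, T)" "perm_chain l (\<sigma>, T) = (A, C)"
      by (metis prod.exhaust)
    then have "card A + card C = card T"
      using cards[OF _ eqs(2)] p pairs by blast
    then show "(case perm_chain l p of (A, C) \<Rightarrow> ?y ^ (d - (card A + card C))) =
        (case p of (\<sigma>, T) \<Rightarrow> ?y ^ (d - card T))"
      by (simp add: eqs)
  qed
  also have "\<dots> = (\<Sum>\<sigma>\<in>?S. \<Sum>T\<in>?T \<sigma>. ?y ^ (d - card T))"
    using fin_S fin_T by (intro sum.Sigma[symmetric]) auto
  also have "\<dots> = (\<Sum>\<sigma>\<in>?S. monom 1 (d - des (d+1) l \<sigma>))"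
  proof (rule sum.cong[OF refl])
    fix \<sigma>
    have "descent_set (d+1) l \<sigma> \<subseteq> {1..d}"
      using descent_set_subset[of "d+1" l \<sigma>] by simp
    then have "(\<Sum>T\<in>?T \<sigma>. ?y ^ (d - card T)) = (1 + ?y) ^ (d - des (d+1) l \<sigma>)"
      using sum_power_interval[of "{1..d}" "descent_set (d+1) l \<sigma>" ?y] by (simp add: des_def)
    also have "1 + ?y = monom 1 1"
      by (simp add: one_pCons monom_Suc)
    finally show "(\<Sum>T\<in>?T \<sigma>. ?y ^ (d - card T)) = monom 1 (d - des (d+1) l \<sigma>)"
      by (simp add: monom_power)
  qed
  finally show ?thesis .
qed

theorem theorem3p4:
  fixes \<Delta> :: "'a set set" and d l j :: nat
  assumes "finite_simplicial_complex \<Delta>"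
    and "complex_dim \<Delta> = int d - 1"
    and "1 \<le> l" and "l \<le> d - 1"
    and "j \<le> d"
  shows "h_vec (partial_sd l \<Delta>) j =
    (\<Sum>\<mu>=0..d. int (A_num (d + 1) (int j) (int d + 1 - int \<mu>) l) * h_vec \<Delta> \<mu>)"
proof -
  have "l \<le> d" "l < d + 1"
    using assms by auto
  let ?k = "\<lambda>\<mu>. d + 1 - \<mu>"
  let ?I = "\<lambda>\<mu>. {{?k \<mu><..d+1}..{1..d+1} - {?k \<mu>}}"
  let ?S = "\<lambda>\<mu>. {\<sigma> \<in> S_perms (d+1) l. \<sigma> (d+1) = ?k \<mu>}"
  have intervals: "finite ({1..d+1} - {?k \<mu>}) \<and> {?k \<mu><..d+1} \<subseteq> {1..d+1} - {?k \<mu>} \<and>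
      card ({1..d+1} - {?k \<mu>}) = d \<and> card {?k \<mu><..d+1} = \<mu>" if "\<mu> \<le> d" for \<mu>
    using that by auto
  have "f_poly (partial_sd l \<Delta>) = (\<Sum>F\<in>\<Delta>. sd_weight d l (card F))"
    by (rule f_poly_partial_sd[OF assms(1,2) \<open>l \<le> d\<close>])
  also have "\<dots> = (\<Sum>\<mu>=0..d. smult (h_vec \<Delta> \<mu>) (\<Sum>F\<in>?I \<mu>. sd_weight d l (card F)))"
    by (rule sum_over_faces_from_h_vec[OF assms(1,2) intervals])
  also have "\<dots> = (\<Sum>\<mu>=0..d. smult (h_vec \<Delta> \<mu>) (\<Sum>\<sigma>\<in>?S \<mu>. monom 1 (d - des (d+1) l \<sigma>)))"
    using \<open>l < d + 1\<close> by (intro sum.cong arg_cong2[where f = smult] refl sum_weights_eq_sum_perms) auto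
  finally have f_poly: "f_poly (partial_sd l \<Delta>) = \<dots>" .
  have count: "coeff (\<Sum>\<sigma>\<in>?S \<mu>. monom 1 (d - des (d+1) l \<sigma>)) (d - j) =
      int (A_num (d + 1) (int j) (int d + 1 - int \<mu>) l)" if "\<mu> \<le> d" for \<mu>
  proof -
    have des_le: "des (d+1) l \<sigma> \<le> d" for \<sigma>
      using card_mono[OF finite_atLeastAtMost descent_set_subset[of "d+1" l \<sigma>]]
      by (simp add: des_def)
    have "finite (?S \<mu>)"
      by (rule finite_subset[OF _ finite_permutations[of "{1..d+1}"]]) (auto simp: S_perms_def)
    then have "coeff (\<Sum>\<sigma>\<in>?S \<mu>. monom (1::int) (d - des (d+1) l \<sigma>)) (d - j) =
        int (card {\<sigma> \<in> ?S \<mu>. d - des (d+1) l \<sigma> = d - j})"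
      by (simp add: coeff_sum sum.If_cases Int_def)
    also have "{\<sigma> \<in> ?S \<mu>. d - des (d+1) l \<sigma> = d - j} =
        {\<sigma> \<in> S_perms (d+1) l. int (des (d+1) l \<sigma>) = int j \<and> int (\<sigma> (d+1)) = int d + 1 - int \<mu>}"
    proof -
      have "\<sigma> (d+1) = ?k \<mu> \<and> d - des (d+1) l \<sigma> = d - j \<longleftrightarrow>
          int (des (d+1) l \<sigma>) = int j \<and> int (\<sigma> (d+1)) = int d + 1 - int \<mu>" for \<sigma>
        using des_le[of \<sigma>] \<open>j \<le> d\<close> \<open>\<mu> \<le> d\<close> by presburger
      then show ?thesis
        by blast
    qed
    finally show ?thesis
      by (simp only: A_num_def)
  qed
  have "nat (complex_dim (partial_sd l \<Delta>) + 1) = d"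
    using complex_dim_partial_sd[OF assms(1,2) \<open>l \<le> d\<close>] by simp
  then have "h_vec (partial_sd l \<Delta>) j = coeff (f_poly (partial_sd l \<Delta>)) (d - j)"
    using \<open>j \<le> d\<close> by (simp add: h_vec_def)
  also have "\<dots> = (\<Sum>\<mu>=0..d. h_vec \<Delta> \<mu> * int (A_num (d + 1) (int j) (int d + 1 - int \<mu>) l))"
    unfolding f_poly coeff_sum coeff_smult using count by (intro sum.cong) (auto simp: coeff_sum)
  finally show ?thesis
    by (simp only: mult.commute)
qed

end
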